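(* Let $R$ be a principal ideal domain and let $f(t),g(t)\in R[t]$ with $g(t)$ monic. Then $f(C_g)$ has precisely $$\max_{p\mid\gamma_r}\deg(\gcd(f_p,g_p))$$ non-unit invariant factors, where $\gamma_r$ is the last non-zero determinantal divisor of $f(C_g)$ and the maximum is taken over all primes $p\in R$ dividing $\gamma_r$.
   Context: For a monic polynomial $g(t)=t^n+\sum_{i=0}^{n-1}g_it^i\in R[t]$, the companion matrix $C_g\in R^{n\times n}$ has first row $(-g_{n-1},\dots,-g_1,-g_0)$, entries $1$ in positions $(i+1,i)$ for $1\le i\le n-1$, and $0$ elsewhere. For $f(t)=\sum_i f_it^i\in R[t]$, $f(C_g)=\sum_i f_iC_g^i$. For $M\in R^{n\times n}$, $\gamma_0(M)=1$ and $\gamma_i(M)$ ($1\le i\le n$) is the GCD of all minors of $M$ of order $i$ (the $i$-th determinantal divisor). The invariant factors of $M$ are the $n$ diagonal entries $s_1\mid s_2\mid\dots\mid s_n$ of its Smith form, i.e. of the diagonal matrix $UMV$ with $U,V$ invertible over $R$. Here zero diagonal entries are also counted as invariant factors (and they are non-units). All these are defined up to units of $R$. For a prime $p\in R$ and $f(t)\in R[t]$, $f_p(t)\in (R/\langle p\rangle)[t]$ denotes the reduction of $f(t)$ modulo the ideal $\langle p\rangle$; $\gcd(f_p,g_p)$ is computed in the polynomial ring over the field $R/\langle p\rangle$.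
   Formalization: Assumes that some prime divides γ_r or that r = deg g: if γ_r is a unit and r < deg g, the maximum is over no primes, yet zero invariant factors exist (R = Z, f = g = t). A maximum over no primes is read as 0. *)

theory Defs
  imports
    "HOL-Algebra.Algebraic_Closure_Type"
    "Jordan_Normal_Form.Determinant"
    "Jordan_Normal_Form.DL_Submatrix"
begin

hide_const (open) Polynomials.degree Polynomials.lead_coeff

(* The ring R is a type of class idom; HOL-Algebra's view of that type (carrier UNIV) is used
   to state that R is a principal ideal domain and to form the quotient rings R/<p>. *)
abbreviation type_ring :: "'a::comm_ring_1 ring" where
  "type_ring \<equiv> ring_of_type_algebra"

(* Rows and columns are indexed from 0, so the first row is
   -g_(n-1), ..., -g_1, -g_0 in columns 0, ..., n-1. *)
definition companion_mat :: "'a::comm_ring_1 poly \<Rightarrow> 'a mat" where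
  "companion_mat g = (let n = degree g in
     mat n n (\<lambda>(i, j). if i = 0 then - poly.coeff g (n - 1 - j)
                        else if i = j + 1 then 1 else 0))"

definition poly_of_mat :: "'a::comm_ring_1 poly \<Rightarrow> 'a mat \<Rightarrow> 'a mat" where
  "poly_of_mat f M = mat (dim_row M) (dim_row M)
     (\<lambda>ij. \<Sum>k\<le>degree f. poly.coeff f k * (M ^\<^sub>m k) $$ ij)"

definition minors :: "'a::comm_ring_1 mat \<Rightarrow> nat \<Rightarrow> 'a set" where
  "minors M i = {det (submatrix M I J) | I J.
     I \<subseteq> {..<dim_row M} \<and> J \<subseteq> {..<dim_col M} \<and> card I = i \<and> card J = i}"

(* GCDs are only determined up to units, hence a predicate. The only minor of order 0 is the
   empty determinant 1, so for i = 0 this says that d is 1 up to a unit. *)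
definition is_determinantal_divisor :: "'a::comm_ring_1 mat \<Rightarrow> nat \<Rightarrow> 'a \<Rightarrow> bool" where
  "is_determinantal_divisor M i d \<longleftrightarrow>
     (\<forall>m\<in>minors M i. d dvd m) \<and> (\<forall>c. (\<forall>m\<in>minors M i. c dvd m) \<longrightarrow> c dvd d)"

definition is_smith_form :: "'a::comm_ring_1 mat \<Rightarrow> 'a mat \<Rightarrow> bool" where
  "is_smith_form M S \<longleftrightarrow>
     (\<exists>U V. U \<in> carrier_mat (dim_row M) (dim_row M) \<and> invertible_mat U \<and>
            V \<in> carrier_mat (dim_col M) (dim_col M) \<and> invertible_mat V \<and>
            S = U * M * V) \<and>
     diagonal_mat S \<and>
     (\<forall>i. i + 1 < min (dim_row S) (dim_col S) \<longrightarrow> S $$ (i, i) dvd S $$ (i + 1, i + 1))"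

definition quot_by :: "'a::comm_ring_1 \<Rightarrow> 'a set ring" where
  "quot_by p = type_ring Quot (PIdl\<^bsub>type_ring\<^esub> p)"

(* HOL-Algebra polynomials are coefficient lists with the leading coefficient first and nonzero,
   so the list of coefficients is reversed and, after reduction, leading zeros are dropped. *)
definition poly_mod :: "'a::comm_ring_1 \<Rightarrow> 'a poly \<Rightarrow> 'a set list" where
  "poly_mod p f = ring.normalize (quot_by p)
     (map (\<lambda>a. PIdl\<^bsub>type_ring\<^esub> p +>\<^bsub>type_ring\<^esub> a) (rev (coeffs f)))"

(* deg (gcd (f_p, g_p)); the degree does not depend on which of the associated gcds is chosen. *)
definition deg_gcd_mod :: "'a::comm_ring_1 \<Rightarrow> 'a poly \<Rightarrow> 'a poly \<Rightarrow> nat" where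
  "deg_gcd_mod p f g =
     Polynomials.degree (somegcd (poly_ring (quot_by p)) (poly_mod p f) (poly_mod p g))"

end

(* Row i of C_g is multiplication of t^(n-1-i) by t modulo g, so the transpose of f(C_g) is
   multiplication by f on R[t]/(g). Modulo a prime p, with d = gcd(f_p, g_p) and g_p = d b,
   the kernel of this map is spanned by b, b t, ..., b t^(deg d - 1) and so has dimension deg d.
   Computed from the Smith form, its dimension is the number of invariant factors divisible by p.
   Determinantal divisors detect ranks modulo a prime and over R, whence p divides gamma_r iff p
   divides a nonzero invariant factor; the maximum is attained at any prime dividing the first
   non-unit invariant factor. All linear algebra over R/<p> is carried out over R with
   divisibility by p in place of vanishing; p = 0 gives the rank over R. *)
theory Submission
  imports Defs
begin

text \<open>The gcd over R/<p> must become data in R[t] before matrices over R can use it. It enters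
  as congruences modulo p: f = d a, g = d b', d = u f + v g. The lift d is chosen monic: then
  division by d, and by the resulting quotient b, which is again monic, can be done in R[t], degrees
  do not drop modulo p, and p can divide d h only by dividing h. Dimensions modulo p are compared
  through families of vectors. The multiples of b bound the kernel from below; the Bezout relation
  forces every kernel element to be a multiple of b modulo p, which bounds it from above. If no
  prime divides gamma_r, the maximum ranges over the empty set. All nonzero invariant factors are
  then units, so either r = n and the count is 0, or zero factors are left that no prime accounts
  for (f = 0 with n > 0 has r = 0 and n non-units). The hypothesis \<open>max_meaningful\<close>
  excludes the latter, and inserting 0 into the set settles the former.\<close>

no_notation fps_nth (infixl "$" 75)
no_notation fls_nth (infixl "$$" 75)

section \<open>Kernels modulo a prime\<close>

text \<open>The principal ideal of \<open>p\<close> is prime exactly in these cases, as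
  \<open>prime_elem\<close> excludes 0. Divisibility by 0 is vanishing, so one argument serves ranks
  over residue fields and the rank over R.\<close>

definition prime_or_zero :: "'a::idom \<Rightarrow> bool" where
  "prime_or_zero p \<longleftrightarrow> p = 0 \<or> prime_elem p"

lemma prime_or_zero_dvd_multD:
  "prime_or_zero p \<Longrightarrow> p dvd a * b \<Longrightarrow> p dvd a \<or> p dvd b"
  by (auto simp: prime_or_zero_def prime_elem_dvd_mult_iff)

lemma prime_or_zero_not_dvd_one: "prime_or_zero p \<Longrightarrow> \<not> p dvd 1"
  by (auto simp: prime_or_zero_def prime_elem_def)

lemma prime_or_zero_dvd_prodD:
  "prime_or_zero p \<Longrightarrow> finite A \<Longrightarrow> p dvd prod f A \<Longrightarrow> \<exists>a\<in>A. p dvd f a"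
  by (induction A rule: infinite_finite_induct)
    (auto dest: prime_or_zero_dvd_multD prime_or_zero_not_dvd_one)

definition dvd_vec :: "'a::comm_ring_1 \<Rightarrow> 'a vec \<Rightarrow> bool" where
  "dvd_vec p v \<longleftrightarrow> (\<forall>i<dim_vec v. p dvd v $ i)"

definition dvd_mat :: "'a::comm_ring_1 \<Rightarrow> 'a mat \<Rightarrow> bool" where
  "dvd_mat p A \<longleftrightarrow> (\<forall>i<dim_row A. \<forall>j<dim_col A. p dvd A $$ (i, j))"

lemma dvd_vec_mult_mat_vec:
  "dvd_vec p v \<Longrightarrow> dim_col A = dim_vec v \<Longrightarrow> dvd_vec p (A *\<^sub>v v)"
  by (auto simp: dvd_vec_def scalar_prod_def intro!: dvd_sum)

lemma dvd_mat_mult: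
  "dvd_mat p B \<Longrightarrow> dim_col A = dim_row B \<Longrightarrow> dvd_mat p (A * B)"
  by (auto simp: dvd_mat_def scalar_prod_def intro!: dvd_sum)

text \<open>Gaussian elimination by cross-multiplication: no pivot is inverted, so it runs over R
  itself, and primality keeps the solution from becoming 0 modulo \<open>p\<close>.\<close>

lemma homogeneous_system_mod:
  fixes p :: "'a::idom"
  assumes p: "prime_or_zero p"
  shows "finite J \<Longrightarrow> m < card J \<Longrightarrow>
    \<exists>c. (\<exists>j\<in>J. \<not> p dvd c j) \<and> (\<forall>i<m. p dvd (\<Sum>j\<in>J. a i j * c j))"
proof (induction m arbitrary: a J)
  case 0
  then show ?case
    using prime_or_zero_not_dvd_one[OF p] by (intro exI[of _ "\<lambda>_. 1"]) (auto simp: card_gt_0_iff)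
next
  case (Suc m)
  show ?case
  proof (cases "\<forall>j\<in>J. p dvd a m j")
    case True
    from Suc.IH[of J a] Suc.prems obtain c where
      "\<exists>j\<in>J. \<not> p dvd c j" "\<forall>i<m. p dvd (\<Sum>j\<in>J. a i j * c j)" by auto
    then show ?thesis using True
      by (intro exI[of _ c]) (auto simp: less_Suc_eq intro!: dvd_sum)
  next
    case False
    then obtain k where k: "k \<in> J" "\<not> p dvd a m k" by blast
    \<comment> \<open>Equation \<open>i\<close> with unknown \<open>k\<close> cleared by the pivot
      \<open>a m k\<close>; for \<open>i = m\<close> nothing is left.\<close>
    define b where "b i j = a m k * a i j - a m j * a i k" for i j
    have "m < card (J - {k})" using Suc.prems k(1) by simp
    with Suc.IH[of "J - {k}" b] Suc.prems(1) obtain c where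
      c: "\<exists>j\<in>J - {k}. \<not> p dvd c j" "\<forall>i<m. p dvd (\<Sum>j\<in>J - {k}. b i j * c j)" by blast
    \<comment> \<open>The smaller solution scaled by the pivot, so that equation \<open>m\<close>
      can be solved for unknown \<open>k\<close> without division.\<close>
    define c' where "c' j = (if j = k then - (\<Sum>j\<in>J - {k}. a m j * c j) else a m k * c j)" for j
    have "(\<Sum>j\<in>J. a i j * c' j) = (\<Sum>j\<in>J - {k}. b i j * c j)" for i
      using Suc.prems(1) k(1)
      by (simp add: sum.remove[of J k] c'_def b_def sum_distrib_left sum_subtractf[symmetric]
          sum_negf[symmetric] sum.distrib[symmetric] algebra_simps)
    moreover have "b m j = 0" for j by (simp add: b_def)
    moreover obtain j where "j \<in> J - {k}" "\<not> p dvd c j" using c(1) by blast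
    then have "j \<in> J" "\<not> p dvd c' j"
      using k(2) prime_or_zero_dvd_multD[OF p, of "a m k" "c j"] by (auto simp: c'_def)
    ultimately show ?thesis using c(2)
      by (intro exI[of _ c']) (auto simp: less_Suc_eq)
  qed
qed

text \<open>Bounds independent families in the kernel from above. In the coordinates
  \<open>Y = Q' * W\<close> the map is diagonal, so the rows of \<open>Y\<close> outside
  \<open>B\<close> vanish modulo \<open>p\<close>; only \<open>card B\<close> equations remain for
  \<open>l\<close> unknown coefficients.\<close>

lemma kernel_dependent_mod:
  fixes p :: "'a::idom"
  assumes p: "prime_or_zero p"
    and carr: "A \<in> carrier_mat n n" "P \<in> carrier_mat n n" "Q \<in> carrier_mat n n"
      "Q' \<in> carrier_mat n n" "W \<in> carrier_mat n l"
    and inv: "Q * Q' = 1\<^sub>m n" and diag: "diagonal_mat (P * A * Q)"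
    and ker: "dvd_mat p (A * W)"
    and less: "card {i. i < n \<and> p dvd (P * A * Q) $$ (i, i)} < l"
  shows "\<exists>c\<in>carrier_vec l. \<not> dvd_vec p c \<and> dvd_vec p (W *\<^sub>v c)"
proof -
  define D where "D = P * A * Q"
  define B where "B = {i. i < n \<and> p dvd D $$ (i, i)}"
  define Y where "Y = Q' * W"
  have Dc: "D \<in> carrier_mat n n" and Yc: "Y \<in> carrier_mat n l" using carr by (auto simp: D_def Y_def)
  have W: "W = Q * Y"
    using carr inv by (simp add: Y_def assoc_mult_mat[of Q n n Q' n W l, symmetric])
  have "D * Y = P * (A * W)"
    using carr Yc by (simp add: D_def W assoc_mult_mat[of _ n n _ n _ l])
  then have DY: "dvd_mat p (D * Y)" using ker carr by (simp add: dvd_mat_mult)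
  have entry: "(D * Y) $$ (i, j) = D $$ (i, i) * Y $$ (i, j)" if "i < n" "j < l" for i j
  proof -
    have "(D * Y) $$ (i, j) = (\<Sum>k\<in>{0..<n}. D $$ (i, k) * Y $$ (k, j))"
      using that Dc Yc by (auto simp: scalar_prod_def)
    also have "\<dots> = (\<Sum>k\<in>{0..<n}. if k = i then D $$ (i, i) * Y $$ (i, j) else 0)"
      using diag Dc that by (intro sum.cong) (auto simp: diagonal_mat_def D_def[symmetric])
    finally show ?thesis using that by simp
  qed
  have good: "p dvd Y $$ (i, j)" if "i < n" "i \<notin> B" "j < l" for i j
  proof -
    have "p dvd D $$ (i, i) * Y $$ (i, j)"
      using DY[unfolded dvd_mat_def, rule_format, of i j] Dc Yc that entry[of i j] by simp
    then show ?thesis using that prime_or_zero_dvd_multD[OF p] by (auto simp: B_def)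
  qed
  have "finite B" by (simp add: B_def)
  then obtain e where e: "bij_betw e {0..<card B} B" using ex_bij_betw_nat_finite by blast
  obtain c where c: "\<exists>j<l. \<not> p dvd c j" "\<forall>i<card B. p dvd (\<Sum>j<l. Y $$ (e i, j) * c j)"
    using homogeneous_system_mod[OF p, of "{..<l}" "card B" "\<lambda>i j. Y $$ (e i, j)"] less
    by (auto simp: B_def D_def)
  have row: "p dvd (\<Sum>j<l. Y $$ (i, j) * c j)" if "i < n" for i
  proof (cases "i \<in> B")
    case True
    then obtain k where "k < card B" "i = e k" using e by (force simp: bij_betw_def)
    then show ?thesis using c(2) by simp
  qed (use good that in \<open>auto intro!: dvd_sum\<close>)
  have "dvd_vec p (Y *\<^sub>v vec l c)"
    using Yc row by (auto simp: dvd_vec_def scalar_prod_def lessThan_atLeast0)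
  then have "dvd_vec p (Q *\<^sub>v (Y *\<^sub>v vec l c))" using carr Yc by (auto intro: dvd_vec_mult_mat_vec)
  then have "dvd_vec p (W *\<^sub>v vec l c)"
    using carr Yc by (simp add: W assoc_mult_mat_vec[of Q n n Y l])
  moreover have "\<not> dvd_vec p (vec l c)" using c(1) by (auto simp: dvd_vec_def)
  ultimately show ?thesis by (intro bexI[of _ "vec l c"]) auto
qed

text \<open>The matching lower bound: the columns of \<open>Q\<close> at the positions in
  \<open>B\<close> are killed modulo \<open>p\<close>, and \<open>Q'\<close> turns them back into
  unit vectors, from which coefficients can be read off.\<close>

lemma kernel_independent_mod:
  fixes A :: "'a::idom mat"
  assumes carr: "A \<in> carrier_mat n n" "P \<in> carrier_mat n n" "P' \<in> carrier_mat n n"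
      "Q \<in> carrier_mat n n" "Q' \<in> carrier_mat n n"
    and inv: "P' * P = 1\<^sub>m n" "Q' * Q = 1\<^sub>m n" and diag: "diagonal_mat (P * A * Q)"
    and m: "m = card {i. i < n \<and> p dvd (P * A * Q) $$ (i, i)}"
  shows "\<exists>Y\<in>carrier_mat n m. dvd_mat p (A * Y) \<and>
    (\<forall>c\<in>carrier_vec m. dvd_vec p (Y *\<^sub>v c) \<longrightarrow> dvd_vec p c)"
proof -
  define D where "D = P * A * Q"
  define B where "B = {i. i < n \<and> p dvd D $$ (i, i)}"
  have mB: "m = card B" by (simp add: m B_def D_def)
  have Dc: "D \<in> carrier_mat n n" using carr by (auto simp: D_def)
  have "finite B" by (simp add: B_def)
  then obtain e where e: "bij_betw e {0..<m} B" using ex_bij_betw_nat_finite mB by blast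
  have eB: "e j \<in> B" if "j < m" for j using e that by (auto simp: bij_betw_def)
  then have en: "e j < n" if "j < m" for j using that by (auto simp: B_def)
  define E where "E = mat n m (\<lambda>(i, j). if i = e j then 1 else 0 :: 'a)"
  define Y where "Y = Q * E"
  have Ec: "E \<in> carrier_mat n m" and Yc: "Y \<in> carrier_mat n m"
    using carr by (auto simp: E_def Y_def)
  have "A * Y = P' * (P * (A * (Q * E)))"
    using carr Ec inv
    by (simp add: Y_def assoc_mult_mat[of P' n n P n _ m, symmetric])
  also have "\<dots> = P' * (D * E)"
    using carr Ec by (simp add: D_def assoc_mult_mat[of _ n n _ n _ m])
  finally have AY: "A * Y = P' * (D * E)" .
  have DE: "(D * E) $$ (i, j) = D $$ (i, e j)" if "i < n" "j < m" for i j
    using that Dc en[of j]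
    by (auto simp: E_def scalar_prod_def if_distrib cong: if_cong)
  have "dvd_mat p (D * E)"
    unfolding dvd_mat_def
  proof (intro allI impI)
    fix i j assume "i < dim_row (D * E)" "j < dim_col (D * E)"
    then have ij: "i < n" "j < m" using Dc Ec by auto
    show "p dvd (D * E) $$ (i, j)"
      using DE[OF ij] eB[OF ij(2)] en[OF ij(2)] diag Dc ij
      by (cases "i = e j") (auto simp: B_def diagonal_mat_def D_def[symmetric])
  qed
  then have "dvd_mat p (A * Y)" unfolding AY using carr Dc Ec by (auto intro: dvd_mat_mult)
  moreover have "dvd_vec p c" if c: "c \<in> carrier_vec m" "dvd_vec p (Y *\<^sub>v c)" for c
  proof -
    have "Q' *\<^sub>v (Y *\<^sub>v c) = E *\<^sub>v c"
      using carr Yc Ec c inv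
      by (simp add: Y_def assoc_mult_mat_vec[of Q n n E m] assoc_mult_mat_vec[of Q' n n Q n, symmetric])
    moreover have "dvd_vec p (Q' *\<^sub>v (Y *\<^sub>v c))"
      using carr Yc c by (intro dvd_vec_mult_mat_vec[OF c(2)]) auto
    ultimately have Ecd: "dvd_vec p (E *\<^sub>v c)" by simp
    have "(E *\<^sub>v c) $ e j = c $ j" if j: "j < m" for j
    proof -
      have "(E *\<^sub>v c) $ e j = (\<Sum>k\<in>{0..<m}. (if e j = e k then 1 else 0) * c $ k)"
        using en[OF j] c by (auto simp: E_def scalar_prod_def)
      also have "\<dots> = (\<Sum>k\<in>{0..<m}. if k = j then c $ j else 0)"
        using e j by (intro sum.cong) (auto simp: bij_betw_def inj_on_def)
      finally show ?thesis using j by simp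
    qed
    then show ?thesis using Ecd c Ec en by (auto simp: dvd_vec_def) metis
  qed
  ultimately show ?thesis using Yc by blast
qed

section \<open>Minors and ranks modulo a prime\<close>

text \<open>A weak form of Cauchy-Binet. Each row of \<open>A * B\<close> is a combination of rows
  of \<open>B\<close>, so by multilinearity the determinant is a combination of determinants of
  \<open>i\<close> rows of \<open>B\<close>, in any order and possibly repeated.\<close>

lemma det_mult_dvd:
  fixes p :: "'a::comm_ring_1"
  assumes A: "A \<in> carrier_mat i n" and B: "B \<in> carrier_mat n i"
    and dvd: "\<And>\<phi>. (\<And>a. a < i \<Longrightarrow> \<phi> a < n) \<Longrightarrow> p dvd det (mat i i (\<lambda>(a, b). B $$ (\<phi> a, b)))"
  shows "p dvd det (A * B)"
proof -
  let ?v = "\<lambda>a k. A $$ (a, k) \<cdot>\<^sub>v row B k"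
  have rows: "row B k \<in> carrier_vec i" for k using B by auto
  have "A * B = mat\<^sub>r i i (\<lambda>a. finsum_vec TYPE('a) i (?v a) {0..<n})"
    using A B rows by (intro eq_matI) (auto simp: index_finsum_vec scalar_prod_def)
  also have "det \<dots> = (\<Sum>f\<in>{f. (\<forall>a\<in>{0..<i}. f a \<in> {0..<n}) \<and> (\<forall>a. a \<notin> {0..<i} \<longrightarrow> f a = a)}.
      det (mat\<^sub>r i i (\<lambda>a. ?v a (f a))))"
    using rows by (intro det_linear_rows_sum) auto
  also have "p dvd \<dots>"
  proof (rule dvd_sum)
    fix f assume f: "f \<in> {f. (\<forall>a\<in>{0..<i}. f a \<in> {0..<n}) \<and> (\<forall>a. a \<notin> {0..<i} \<longrightarrow> f a = a)}"
    then have lt: "f a < n" if "a < i" for a using that by simp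
    have "det (mat\<^sub>r i i (\<lambda>a. ?v a (f a))) =
        prod (\<lambda>a. A $$ (a, f a)) {0..<i} * det (mat\<^sub>r i i (\<lambda>a. row B (f a)))"
      by (intro det_rows_mul) (use rows in \<open>auto simp: Pi_iff\<close>)
    also have "mat\<^sub>r i i (\<lambda>a. row B (f a)) = mat i i (\<lambda>(a, b). B $$ (f a, b))"
      using B lt by (intro eq_matI) auto
    finally show "p dvd det (mat\<^sub>r i i (\<lambda>a. ?v a (f a)))"
      using dvd[of f] lt by simp
  qed
  finally show ?thesis .
qed

text \<open>\<open>pick\<close> lists a set in increasing order, as \<open>submatrix\<close> does;
  an injective choice of indices lists the same set in another order.\<close>

lemma ex_permutes_pick:
  assumes inj: "inj_on \<phi> {0..<i}"
  obtains \<pi> where "\<pi> permutes {0..<i}" "\<And>a. a < i \<Longrightarrow> pick (\<phi> ` {0..<i}) (\<pi> a) = \<phi> a"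
proof -
  define I where "I = \<phi> ` {0..<i}"
  have I: "finite I" "card I = i" using inj by (auto simp: I_def card_image)
  \<comment> \<open>The position of \<open>\<phi> a\<close> in the increasing list is the number of
    smaller elements.\<close>
  define \<pi> where "\<pi> a = (if a < i then card {x\<in>I. x < \<phi> a} else a)" for a
  have pick: "pick I (\<pi> a) = \<phi> a" if "a < i" for a
    using that by (auto simp: \<pi>_def I_def pick_card_in_set)
  have lt: "\<pi> a < i" if "a < i" for a
  proof -
    have "{x\<in>I. x < \<phi> a} \<subset> I" using that by (auto simp: I_def)
    then show ?thesis using psubset_card_mono[OF I(1)] I(2) that by (auto simp: \<pi>_def)
  qed
  have "inj_on \<pi> {0..<i}"
  proof (rule inj_onI)
    fix a b assume ab: "a \<in> {0..<i}" "b \<in> {0..<i}" "\<pi> a = \<pi> b"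
    then have "\<phi> a = \<phi> b" using pick[of a] pick[of b] by simp
    then show "a = b" using inj_onD[OF inj] ab by blast
  qed
  then have "\<pi> ` {0..<i} = {0..<i}" using lt by (intro endo_inj_surj) auto
  with \<open>inj_on \<pi> {0..<i}\<close> have "\<pi> permutes {0..<i}"
    by (intro bij_imp_permutes) (auto simp: bij_betw_def \<pi>_def)
  then show ?thesis using that[of \<pi>] pick by (simp add: I_def)
qed

text \<open>Multilinear expansion produces index maps instead of index sets. A repeated index gives
  determinant 0; otherwise reordering rows and columns changes a true minor only by a sign.\<close>

lemma generalized_minor_dvd:
  fixes M :: "'a::comm_ring_1 mat"
  assumes dvd: "\<And>x. x \<in> minors M i \<Longrightarrow> p dvd x"
    and \<phi>: "\<And>a. a < i \<Longrightarrow> \<phi> a < dim_row M" and \<psi>: "\<And>a. a < i \<Longrightarrow> \<psi> a < dim_col M"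
  shows "p dvd det (mat i i (\<lambda>(a, b). M $$ (\<phi> a, \<psi> b)))" (is "_ dvd det ?N")
proof -
  consider (row) "\<not> inj_on \<phi> {0..<i}" | (col) "\<not> inj_on \<psi> {0..<i}"
    | (inj) "inj_on \<phi> {0..<i}" "inj_on \<psi> {0..<i}"
    by blast
  then show ?thesis
  proof cases
    case row
    then obtain a b where "a < i" "b < i" "a \<noteq> b" "\<phi> a = \<phi> b" by (auto simp: inj_on_def)
    then have "det ?N = 0"
      by (intro det_identical_rows[of _ i a b]) (auto intro!: eq_vecI)
    then show ?thesis by simp
  next
    case col
    then obtain a b where "a < i" "b < i" "a \<noteq> b" "\<psi> a = \<psi> b" by (auto simp: inj_on_def)
    then have "det (transpose_mat ?N) = 0"
      by (intro det_identical_rows[of _ i a b]) (auto intro!: eq_vecI)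
    then show ?thesis by (simp add: det_transpose[of _ i])
  next
    case inj
    define I where "I = \<phi> ` {0..<i}"
    define J where "J = \<psi> ` {0..<i}"
    have I: "I \<subseteq> {..<dim_row M}" "card I = i" and J: "J \<subseteq> {..<dim_col M}" "card J = i"
      using inj \<phi> \<psi> by (auto simp: I_def J_def card_image)
    define B where "B = submatrix M I J"
    have "{a. a < dim_row M \<and> a \<in> I} = I" "{a. a < dim_col M \<and> a \<in> J} = J" using I J by auto
    then have B: "B = mat i i (\<lambda>(a, b). M $$ (pick I a, pick J b))"
      using I J by (simp add: B_def submatrix_def)
    obtain \<pi> where \<pi>: "\<pi> permutes {0..<i}" "\<And>a. a < i \<Longrightarrow> pick I (\<pi> a) = \<phi> a"
      unfolding I_def using ex_permutes_pick[OF inj(1)] by blast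
    obtain \<sigma> where \<sigma>: "\<sigma> permutes {0..<i}" "\<And>a. a < i \<Longrightarrow> pick J (\<sigma> a) = \<psi> a"
      unfolding J_def using ex_permutes_pick[OF inj(2)] by blast
    have lt: "\<pi> a < i" "\<sigma> a < i" if "a < i" for a
      using permutes_in_image[OF \<pi>(1)] permutes_in_image[OF \<sigma>(1)] that by auto
    \<comment> \<open>Columns are permuted as rows of the transpose: \<open>transpose_mat C\<close>
      is \<open>B\<close> with its columns reordered.\<close>
    define C where "C = mat i i (\<lambda>(a, b). transpose_mat B $$ (\<sigma> a, b))"
    have Bc: "B \<in> carrier_mat i i" and Cc: "C \<in> carrier_mat i i" by (auto simp: B C_def)
    have "?N = mat i i (\<lambda>(a, b). transpose_mat C $$ (\<pi> a, b))"
      using \<pi>(2) \<sigma>(2) lt by (intro eq_matI) (auto simp: C_def B)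
    then have "det ?N = signof \<pi> * det C"
      using det_permute_rows[OF _ \<pi>(1), of "transpose_mat C"] Cc by (simp add: det_transpose)
    also have "det C = signof \<sigma> * det B"
      unfolding C_def using det_permute_rows[OF _ \<sigma>(1), of "transpose_mat B"] Bc
      by (simp add: det_transpose)
    finally have "det ?N = signof \<pi> * (signof \<sigma> * det B)" .
    moreover have "det B \<in> minors M i" using I J unfolding minors_def B_def by blast
    ultimately show ?thesis using dvd by simp
  qed
qed

text \<open>Row expansion handles the left factor; the right factor is reached by transposing and
  expanding once more.\<close>

lemma minors_dvd_det_mult:
  fixes M :: "'a::comm_ring_1 mat"
  assumes dvd: "\<And>x. x \<in> minors M i \<Longrightarrow> p dvd x"
    and M: "M \<in> carrier_mat m n" and A: "A \<in> carrier_mat i m" and B: "B \<in> carrier_mat n i"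
  shows "p dvd det (A * (M * B))"
proof (rule det_mult_dvd[OF A])
  show "M * B \<in> carrier_mat m i" using M B by simp
  fix \<phi> assume \<phi>: "\<And>a. a < i \<Longrightarrow> \<phi> a < m"
  define N where "N = mat i n (\<lambda>(a, b). M $$ (\<phi> a, b))"
  have N: "N \<in> carrier_mat i n" by (simp add: N_def)
  have "mat i i (\<lambda>(a, b). (M * B) $$ (\<phi> a, b)) = N * B"
    using M B \<phi> by (intro eq_matI) (auto simp: N_def scalar_prod_def)
  also have "det (N * B) = det (transpose_mat B * transpose_mat N)"
    using N B det_transpose[of "N * B" i] by (simp add: transpose_mult[of N i n B i])
  also have "p dvd \<dots>"
  proof (rule det_mult_dvd)
    show "transpose_mat B \<in> carrier_mat i n" "transpose_mat N \<in> carrier_mat n i" using N B by auto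
    fix \<psi> assume \<psi>: "\<And>a. a < i \<Longrightarrow> \<psi> a < n"
    have "mat i i (\<lambda>(a, b). transpose_mat N $$ (\<psi> a, b)) =
        transpose_mat (mat i i (\<lambda>(a, b). M $$ (\<phi> a, \<psi> b)))"
      using \<psi> by (intro eq_matI) (auto simp: N_def)
    then show "p dvd det (mat i i (\<lambda>(a, b). transpose_mat N $$ (\<psi> a, b)))"
      using generalized_minor_dvd[OF dvd, where \<phi> = \<phi> and \<psi> = \<psi>] \<phi> \<psi> M by (simp add: det_transpose[of _ i])
  qed
  finally show "p dvd det (mat i i (\<lambda>(a, b). (M * B) $$ (\<phi> a, b)))" .
qed

text \<open>Selection by 0-1 matrices lets minors be moved through the factors of a diagonalization
  by associativity alone.\<close>

lemma generalized_minor_eq_mult: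
  fixes M :: "'a::comm_ring_1 mat"
  assumes M: "M \<in> carrier_mat m n"
    and \<phi>: "\<And>a. a < i \<Longrightarrow> \<phi> a < m" and \<psi>: "\<And>a. a < i \<Longrightarrow> \<psi> a < n"
  shows "mat i i (\<lambda>(a, b). M $$ (\<phi> a, \<psi> b)) =
    mat i m (\<lambda>(a, k). if k = \<phi> a then 1 else 0) * (M * mat n i (\<lambda>(k, b). if k = \<psi> b then 1 else 0))"
    (is "_ = ?E * (M * ?F)")
proof (rule eq_matI, goal_cases)
  case (1 a b)
  then have ab: "a < i" "b < i" using M by auto
  have MF: "(M * ?F) $$ (k, b) = M $$ (k, \<psi> b)" if "k < m" for k
    using that M ab \<psi> by (auto simp: scalar_prod_def if_distrib cong: if_cong)
  have "(?E * (M * ?F)) $$ (a, b) = row ?E a \<bullet> col (M * ?F) b"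
    using ab M by (intro index_mult_mat(1)) auto
  also have "\<dots> = (\<Sum>k\<in>{0..<m}. (if k = \<phi> a then 1 else 0) * (M * ?F) $$ (k, b))"
    using ab M by (auto simp: scalar_prod_def simp del: index_mult_mat(1) intro!: sum.cong)
  also have "\<dots> = (\<Sum>k\<in>{0..<m}. if k = \<phi> a then M $$ (\<phi> a, \<psi> b) else 0)"
    using MF by (intro sum.cong) auto
  finally show ?case using ab \<phi> by simp
qed (use M in auto)

text \<open>If the rank modulo \<open>p\<close> is below \<open>i\<close>, the submatrix kills a
  vector that is nonzero modulo \<open>p\<close>, and the adjugate converts this into divisibility
  of its determinant.\<close>

lemma minor_dvd_if_rank_less:
  fixes p :: "'a::idom"
  assumes p: "prime_or_zero p"
    and carr: "M \<in> carrier_mat n n" "P \<in> carrier_mat n n" "P' \<in> carrier_mat n n"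
      "Q \<in> carrier_mat n n" "Q' \<in> carrier_mat n n"
    and inv: "P' * P = 1\<^sub>m n" "Q * Q' = 1\<^sub>m n" and diag: "diagonal_mat (P * M * Q)"
    and less: "card {j. j < n \<and> \<not> p dvd (P * M * Q) $$ (j, j)} < i"
    and x: "x \<in> minors M i"
  shows "p dvd x"
proof -
  define D where "D = P * M * Q"
  define B where "B = {j. j < n \<and> \<not> p dvd D $$ (j, j)}"
  have D: "D \<in> carrier_mat n n" using carr by (simp add: D_def)
  from x carr obtain I J where IJ: "I \<subseteq> {..<n}" "J \<subseteq> {..<n}" "card I = i" "card J = i"
    and x: "x = det (submatrix M I J)" by (auto simp: minors_def)
  have "{a. a < n \<and> a \<in> I} = I" "{a. a < n \<and> a \<in> J} = J" using IJ by auto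
  then have "submatrix M I J = mat i i (\<lambda>(a, b). M $$ (pick I a, pick J b))"
    using IJ carr by (simp add: submatrix_def)
  moreover have "pick I a < n" "pick J a < n" if "a < i" for a
    using pick_in_set_le[of a I] pick_in_set_le[of a J] IJ that by auto
  ultimately obtain E F where EF: "E \<in> carrier_mat i n" "F \<in> carrier_mat n i"
    and sub: "submatrix M I J = E * (M * F)"
    using generalized_minor_eq_mult[of M n n i "pick I" "pick J"] carr mat_carrier by metis
  define Y where "Y = Q' * F"
  have Y: "Y \<in> carrier_mat n i" using carr EF by (simp add: Y_def)
  have "E * (M * F) = (E * P') * (D * Y)"
  proof -
    have "Q * Y = F"
      using carr EF inv by (simp add: Y_def assoc_mult_mat[of Q n n Q' n F i, symmetric])
    then have "D * Y = P * (M * F)"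
      using carr EF Y
      by (simp add: D_def assoc_mult_mat[of _ n n _ n _ n] assoc_mult_mat[of _ n n _ n _ i])
    then have "P' * (D * Y) = M * F"
      using carr EF inv by (simp add: assoc_mult_mat[of P' n n P n "M * F" i, symmetric])
    then show ?thesis
      using carr EF D Y by (simp add: assoc_mult_mat[of E i n P' n "D * Y" i])
  qed
  then have N: "submatrix M I J = (E * P') * (D * Y)" using sub by simp
  define N where "N = submatrix M I J"
  have Nc: "N \<in> carrier_mat i i" unfolding N_def sub using carr EF by simp
  have "finite B" by (simp add: B_def)
  then obtain e where e: "bij_betw e {0..<card B} B" using ex_bij_betw_nat_finite by blast
  \<comment> \<open>Only the rows of \<open>Y\<close> in \<open>B\<close> impose conditions: at
    every other position the diagonal entry of \<open>D\<close> is itself divisible by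
    \<open>p\<close>.\<close>
  obtain c where c: "\<exists>b<i. \<not> p dvd c b" "\<forall>k<card B. p dvd (\<Sum>b<i. Y $$ (e k, b) * c b)"
    using homogeneous_system_mod[OF p, of "{..<i}" "card B" "\<lambda>i j. Y $$ (e i, j)"] less
    by (auto simp: B_def D_def)
  have "dvd_vec p (D *\<^sub>v (Y *\<^sub>v vec i c))"
    unfolding dvd_vec_def
  proof (intro allI impI)
    fix j assume "j < dim_vec (D *\<^sub>v (Y *\<^sub>v vec i c))"
    then have j: "j < n" using D by simp
    have "(D *\<^sub>v (Y *\<^sub>v vec i c)) $ j = (\<Sum>k\<in>{0..<n}. D $$ (j, k) * (Y *\<^sub>v vec i c) $ k)"
      using D Y j by (auto simp: scalar_prod_def)
    also have "\<dots> = (\<Sum>k\<in>{0..<n}. if k = j then D $$ (j, j) * (Y *\<^sub>v vec i c) $ j else 0)"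
      using diag D j by (intro sum.cong) (auto simp: diagonal_mat_def D_def[symmetric])
    also have "\<dots> = D $$ (j, j) * (\<Sum>b<i. Y $$ (j, b) * c b)"
      using j Y by (auto simp: scalar_prod_def lessThan_atLeast0)
    finally have eq: "(D *\<^sub>v (Y *\<^sub>v vec i c)) $ j = D $$ (j, j) * (\<Sum>b<i. Y $$ (j, b) * c b)" .
    show "p dvd (D *\<^sub>v (Y *\<^sub>v vec i c)) $ j"
    proof (cases "j \<in> B")
      case True
      then obtain k where "k < card B" "j = e k" using e by (force simp: bij_betw_def)
      then show ?thesis using c(2) eq by simp
    qed (use j eq in \<open>auto simp: B_def\<close>)
  qed
  then have "dvd_vec p ((E * P') *\<^sub>v (D *\<^sub>v (Y *\<^sub>v vec i c)))"
    using EF carr D by (auto intro: dvd_vec_mult_mat_vec)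
  also have "(E * P') *\<^sub>v (D *\<^sub>v (Y *\<^sub>v vec i c)) = N *\<^sub>v vec i c"
    using EF carr D Y by (simp add: N_def N assoc_mult_mat_vec[of _ i n _ i] assoc_mult_mat_vec[of D n n Y i])
  finally have "dvd_vec p (N *\<^sub>v vec i c)" .
  \<comment> \<open>The adjugate replaces \<open>N\<close> by the scalar \<open>det N\<close>
    without any inversion; some entry of \<open>c\<close> is not divisible by \<open>p\<close>, so
    primality finishes.\<close>
  then have "dvd_vec p (adj_mat N *\<^sub>v (N *\<^sub>v vec i c))"
    using adj_mat[OF Nc] Nc by (auto intro: dvd_vec_mult_mat_vec)
  also have "adj_mat N *\<^sub>v (N *\<^sub>v vec i c) = (adj_mat N * N) *\<^sub>v vec i c"
    using adj_mat(1)[OF Nc] Nc by (intro assoc_mult_mat_vec[symmetric]) auto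
  also have "\<dots> = (det N \<cdot>\<^sub>m 1\<^sub>m i) *\<^sub>v vec i c"
    by (simp only: adj_mat(3)[OF Nc])
  also have "\<dots> = det N \<cdot>\<^sub>v vec i c" by (intro eq_vecI) auto
  finally have "p dvd det N * c b" if "b < i" for b using that by (auto simp: dvd_vec_def)
  then show ?thesis using c(1) prime_or_zero_dvd_multD[OF p] by (auto simp: x N_def)
qed

text \<open>A principal minor of the diagonal matrix at \<open>i\<close> positions in
  \<open>B\<close> is a product of elements not divisible by \<open>p\<close>. It is also the
  determinant of a product with \<open>M\<close> in the middle, so \<open>p\<close> would divide it
  if \<open>p\<close> divided all minors of \<open>M\<close> of order \<open>i\<close>.\<close>

lemma ex_minor_not_dvd_if_le_rank:
  fixes p :: "'a::idom"
  assumes p: "prime_or_zero p"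
    and carr: "M \<in> carrier_mat n n" "P \<in> carrier_mat n n" "Q \<in> carrier_mat n n"
    and diag: "diagonal_mat (P * M * Q)"
    and le: "i \<le> card {j. j < n \<and> \<not> p dvd (P * M * Q) $$ (j, j)}"
  shows "\<exists>x\<in>minors M i. \<not> p dvd x"
proof (rule ccontr)
  assume "\<not> ?thesis"
  then have dvd: "p dvd x" if "x \<in> minors M i" for x using that by blast
  define D where "D = P * M * Q"
  define B where "B = {j. j < n \<and> \<not> p dvd D $$ (j, j)}"
  have D: "D \<in> carrier_mat n n" using carr by (simp add: D_def)
  have off_diag: "D $$ (a, b) = 0" if "a < n" "b < n" "a \<noteq> b" for a b
    using diag D that unfolding D_def[symmetric] diagonal_mat_def by auto
  have "finite B" by (simp add: B_def)
  then obtain e where e: "bij_betw e {0..<card B} B" using ex_bij_betw_nat_finite by blast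
  have le: "i \<le> card B" using le by (simp add: B_def D_def)
  then have eB: "e a \<in> B" if "a < i" for a using e that by (auto simp: bij_betw_def)
  then have en: "e a < n" if "a < i" for a using that by (auto simp: B_def)
  have inj: "e a \<noteq> e b" if "a < i" "b < i" "a \<noteq> b" for a b
    using e le that by (auto simp: bij_betw_def inj_on_def)
  let ?N = "mat i i (\<lambda>(a, b). D $$ (e a, e b))"
  obtain E F where EF: "E \<in> carrier_mat i n" "F \<in> carrier_mat n i" and N: "?N = E * (D * F)"
    using generalized_minor_eq_mult[OF D, of i e e] en mat_carrier by metis
  have "D * F = P * (M * (Q * F))"
    using carr EF by (simp add: D_def assoc_mult_mat[of _ n n _ n _ n] assoc_mult_mat[of _ n n _ n _ i])
  then have "E * (D * F) = (E * P) * (M * (Q * F))"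
    using carr EF by (simp add: assoc_mult_mat[of E i n P n "M * (Q * F)" i])
  moreover have "p dvd det ((E * P) * (M * (Q * F)))"
    using carr EF by (intro minors_dvd_det_mult[OF dvd carr(1)]) auto
  ultimately have "p dvd det ?N" unfolding N by simp
  also have "det ?N = prod_list (diag_mat ?N)"
    using off_diag inj en by (intro det_upper_triangular[of _ i]) auto
  also have "\<dots> = (\<Prod>a\<in>{0..<i}. D $$ (e a, e a))"
    by (simp add: prod_list_diag_prod)
  finally have "p dvd (\<Prod>a\<in>{0..<i}. D $$ (e a, e a))" .
  from prime_or_zero_dvd_prodD[OF p finite_atLeastLessThan this]
  obtain a where "a < i" "p dvd D $$ (e a, e a)" by auto
  then show False using eB[of a] by (simp add: B_def)
qed

section \<open>The companion matrix as multiplication by t\<close>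

text \<open>Pseudo-division multiplies the dividend by a power of the leading coefficient, here
  1.\<close>

lemma monic_division:
  fixes g :: "'a::idom poly"
  assumes "lead_coeff g = 1"
  obtains q r where "f = g * q + r" "r = 0 \<or> degree r < degree g"
proof -
  obtain q r where qr: "pseudo_divmod f g = (q, r)" by fastforce
  from assms have "g \<noteq> 0" by auto
  from pseudo_divmod[OF this qr] assms show ?thesis by (intro that[of q r]) auto
qed

text \<open>R[t]/(g) is free on the powers of t below the degree of \<open>g\<close>, so
  divisibility by a constant modulo \<open>g\<close> shows on the reduced representative:
  \<open>h\<close> minus \<open>c\<close> times the remainder of \<open>z\<close> is a multiple of
  \<open>g\<close> of too small a degree, hence 0.\<close>

lemma const_dvd_if_cong_monic:
  fixes g :: "'a::idom poly"
  assumes g: "lead_coeff g = 1" and deg: "h = 0 \<or> degree h < degree g"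
    and dvd: "g dvd h - [:c:] * z"
  shows "[:c:] dvd h"
proof -
  obtain q r where qr: "z = g * q + r" "r = 0 \<or> degree r < degree g"
    using monic_division[OF g] by blast
  have "g dvd h - [:c:] * z + g * ([:c:] * q)" by (rule dvd_add[OF dvd dvd_triv_left])
  also have "h - [:c:] * z + g * ([:c:] * q) = h - [:c:] * r" by (simp add: qr algebra_simps)
  finally have dvd': "g dvd h - smult c r" by simp
  have "h - smult c r = 0"
  proof (rule ccontr)
    assume nz: "h - smult c r \<noteq> 0"
    have "degree (h - smult c r) < degree g"
    proof (cases "h = 0 \<or> smult c r = 0")
      case True
      then show ?thesis using deg qr(2) nz degree_smult_le[of c r] by auto
    next
      case False
      then show ?thesis using deg qr(2) degree_smult_le[of c r]
        by (intro degree_diff_less) auto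
    qed
    then show False using dvd_imp_degree_le[OF dvd' nz] by simp
  qed
  then have "h = [:c:] * r" by simp
  then show ?thesis by (metis dvd_triv_left)
qed

text \<open>A prime of R stays prime as a constant polynomial, and it cannot divide the leading
  coefficient 1.\<close>

lemma prime_const_dvd_monic_multD:
  fixes d :: "'a::idom poly"
  assumes p: "prime_elem p" and d: "lead_coeff d = 1" and dvd: "[:p:] dvd d * h"
  shows "[:p:] dvd h"
proof -
  have "\<not> [:p:] dvd d"
  proof
    assume "[:p:] dvd d"
    then have "p dvd lead_coeff d" by (simp only: const_poly_dvd_iff)
    then show False using p d by (auto simp: prime_elem_def)
  qed
  then show ?thesis using dvd prime_elem_dvd_multD[OF lift_prime_elem_poly[OF p]] by blast
qed

text \<open>The coordinate order matches the companion matrix, whose row \<open>i\<close> describes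
  the multiplication of \<open>t\<^sup>n\<^sup>-\<^sup>1\<^sup>-\<^sup>i\<close> by \<open>t\<close> modulo \<open>g\<close>.\<close>
definition vec_poly :: "'a::comm_ring_1 vec \<Rightarrow> 'a poly" where
  "vec_poly w = (\<Sum>i<dim_vec w. Polynomial.monom (w $ i) (dim_vec w - 1 - i))"

lemma coeff_vec_poly:
  "poly.coeff (vec_poly w) m = (if m < dim_vec w then w $ (dim_vec w - 1 - m) else 0)"
proof -
  have "poly.coeff (vec_poly w) m =
      (\<Sum>i<dim_vec w. if m < dim_vec w \<and> i = dim_vec w - 1 - m then w $ i else 0)"
    unfolding vec_poly_def coeff_sum by (intro sum.cong) auto
  then show ?thesis by auto
qed

lemma degree_vec_poly: "vec_poly w = 0 \<or> degree (vec_poly w) < dim_vec w"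
proof (cases "vec_poly w = 0")
  case False
  then have "poly.coeff (vec_poly w) (degree (vec_poly w)) \<noteq> 0" by simp
  then show ?thesis unfolding coeff_vec_poly by (simp split: if_splits)
qed simp

lemma const_dvd_vec_poly_iff:
  fixes p :: "'a::idom"
  shows "[:p:] dvd vec_poly w \<longleftrightarrow> dvd_vec p w"
proof
  assume dvd: "[:p:] dvd vec_poly w"
  show "dvd_vec p w"
    unfolding dvd_vec_def
  proof (intro allI impI)
    fix i assume "i < dim_vec w"
    then have "poly.coeff (vec_poly w) (dim_vec w - 1 - i) = w $ i" by (simp add: coeff_vec_poly)
    moreover have "p dvd poly.coeff (vec_poly w) (dim_vec w - 1 - i)"
      using dvd by (simp only: const_poly_dvd_iff)
    ultimately show "p dvd w $ i" by simp
  qed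
qed (simp add: const_poly_dvd_iff coeff_vec_poly dvd_vec_def)

lemma smult_sum_right: "smult a (sum f A) = (\<Sum>x\<in>A. smult a (f x))"
  by (induction A rule: infinite_finite_induct) (auto simp: smult_add_right)

lemma vec_poly_mult_mat_vec:
  assumes "A \<in> carrier_mat n l" "c \<in> carrier_vec l"
  shows "vec_poly (A *\<^sub>v c) = (\<Sum>j<l. smult (c $ j) (vec_poly (col A j)))"
proof (rule poly_eqI)
  fix m
  show "poly.coeff (vec_poly (A *\<^sub>v c)) m = poly.coeff (\<Sum>j<l. smult (c $ j) (vec_poly (col A j))) m"
    using assms by (auto simp: coeff_vec_poly coeff_sum scalar_prod_def lessThan_atLeast0 mult.commute)
qed

lemma vec_poly_vec:
  assumes "q = 0 \<or> degree q < n"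
  shows "vec_poly (vec n (\<lambda>i. poly.coeff q (n - Suc i))) = q"
  using assms by (intro poly_eqI) (auto simp: coeff_vec_poly intro: coeff_eq_0)

text \<open>Row 0 is t^n reduced once, and the difference is exactly \<open>- g\<close>. In any
  other row the single 1, at column \<open>j - 1\<close>, already is the required monomial.\<close>

lemma vec_poly_row_companion_mat:
  fixes g :: "'a::comm_ring_1 poly"
  assumes g: "lead_coeff g = 1" and j: "j < degree g"
  shows "g dvd vec_poly (row (companion_mat g) j) - Polynomial.monom 1 (degree g - j)"
proof (cases "j = 0")
  case True
  let ?n = "degree g"
  have "vec_poly (row (companion_mat g) j) =
      (\<Sum>i<?n. Polynomial.monom (- poly.coeff g (?n - Suc i)) (?n - Suc i))"
    using j True by (auto simp: vec_poly_def companion_mat_def Let_def intro!: sum.cong)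
  also have "\<dots> = (\<Sum>i<?n. Polynomial.monom (- poly.coeff g i) i)"
    by (rule sum.nat_diff_reindex)
  also have "\<dots> = - (\<Sum>i<?n. Polynomial.monom (poly.coeff g i) i)"
    by (simp add: minus_monom[symmetric] sum_negf)
  finally have "vec_poly (row (companion_mat g) j) - Polynomial.monom 1 (?n - j) =
      - (\<Sum>i\<le>?n. Polynomial.monom (poly.coeff g i) i)"
    using g True by (simp add: lessThan_Suc_atMost[symmetric])
  then show ?thesis by (simp add: poly_as_sum_of_monoms)
next
  case False
  have "vec_poly (row (companion_mat g) j) = Polynomial.monom 1 (degree g - j)"
  proof (rule poly_eqI)
    fix m
    show "poly.coeff (vec_poly (row (companion_mat g) j)) m =
        poly.coeff (Polynomial.monom 1 (degree g - j)) m"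
      using False j by (auto simp: coeff_vec_poly companion_mat_def Let_def)
  qed
  then show ?thesis by simp
qed

lemma companion_mat_carrier: "companion_mat g \<in> carrier_mat (degree g) (degree g)"
  by (simp add: companion_mat_def Let_def)

lemma vec_poly_row_companion_mat_power:
  fixes g :: "'a::comm_ring_1 poly"
  assumes g: "lead_coeff g = 1" and j: "j < degree g"
  shows "g dvd vec_poly (row (companion_mat g ^\<^sub>m k) j) - Polynomial.monom 1 (k + (degree g - 1 - j))"
proof (induction k)
  case 0
  have "vec_poly (row (1\<^sub>m (degree g)) j) = (Polynomial.monom 1 (degree g - 1 - j) :: 'a poly)"
  proof (rule poly_eqI)
    fix m
    show "poly.coeff (vec_poly (row (1\<^sub>m (degree g)) j)) m =
        poly.coeff (Polynomial.monom 1 (degree g - 1 - j) :: 'a poly) m"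
      using j by (auto simp: coeff_vec_poly)
  qed
  then show ?case using companion_mat_carrier[of g] by simp
next
  case (Suc k)
  let ?n = "degree g" and ?C = "companion_mat g"
  let ?t = "Polynomial.monom (1 :: 'a) 1"
  note C = companion_mat_carrier[of g]
  have Ck: "?C ^\<^sub>m k \<in> carrier_mat ?n ?n" using C by simp
  define w where "w = row (?C ^\<^sub>m k) j"
  have w: "w \<in> carrier_vec ?n"
    by (intro carrier_vecI) (simp only: w_def index_row(2) carrier_matD(2)[OF Ck])
  \<comment> \<open>The next power combines the rows of the companion matrix with the entries of
    \<open>w\<close> as coefficients: each basis monomial in \<open>vec_poly w\<close> is replaced
    by its product with t modulo \<open>g\<close>.\<close>
  have "row (?C ^\<^sub>m Suc k) j = transpose_mat ?C *\<^sub>v w"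
    using C Ck w j carrier_matD[OF C] carrier_matD[OF Ck]
    by (intro eq_vecI) (auto simp: w_def[symmetric] comm_scalar_prod[of _ ?n])
  then have "vec_poly (row (?C ^\<^sub>m Suc k) j) = (\<Sum>l<?n. smult (w $ l) (vec_poly (row ?C l)))"
    using C w by (simp add: vec_poly_mult_mat_vec[of _ ?n ?n])
  moreover have "?t * vec_poly w = (\<Sum>l<?n. smult (w $ l) (Polynomial.monom 1 (?n - l)))"
    using w by (auto simp: vec_poly_def sum_distrib_left mult_monom smult_monom Suc_diff_Suc
        intro!: sum.cong)
  \<comment> \<open>The error splits into the reductions made by the single rows and t times the old
    error.\<close>
  ultimately have "vec_poly (row (?C ^\<^sub>m Suc k) j) - Polynomial.monom 1 (Suc k + (?n - 1 - j)) =
      (\<Sum>l<?n. smult (w $ l) (vec_poly (row ?C l) - Polynomial.monom 1 (?n - l))) +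
      ?t * (vec_poly w - Polynomial.monom 1 (k + (?n - 1 - j)))"
    by (simp add: algebra_simps sum_subtractf smult_diff_right mult_monom)
  moreover have "g dvd (\<Sum>l<?n. smult (w $ l) (vec_poly (row ?C l) - Polynomial.monom 1 (?n - l)))"
    using vec_poly_row_companion_mat[OF g] by (intro dvd_sum dvd_smult) auto
  ultimately show ?case using Suc.IH by (simp add: w_def)
qed

text \<open>By linearity both sides are double sums with the same scalars, and they differ by a
  multiple of \<open>g\<close> term by term.\<close>

lemma vec_poly_poly_of_companion_mat:
  fixes g :: "'a::comm_ring_1 poly"
  assumes g: "lead_coeff g = 1" and x: "x \<in> carrier_vec (degree g)"
  shows "g dvd vec_poly (transpose_mat (poly_of_mat f (companion_mat g)) *\<^sub>v x) - f * vec_poly x"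
proof -
  let ?n = "degree g" and ?C = "companion_mat g"
  let ?M = "poly_of_mat f ?C"
  note C = companion_mat_carrier[of g]
  have M: "?M \<in> carrier_mat ?n ?n" using C by (simp add: poly_of_mat_def)
  have Ck: "?C ^\<^sub>m k \<in> carrier_mat ?n ?n" for k using C by simp
  have row: "vec_poly (row ?M j) = (\<Sum>k\<le>degree f. smult (poly.coeff f k) (vec_poly (row (?C ^\<^sub>m k) j)))"
    if "j < ?n" for j
    using that C carrier_matD[OF Ck]
    by (intro poly_eqI) (auto simp: coeff_vec_poly coeff_sum poly_of_mat_def)
  have "vec_poly (transpose_mat ?M *\<^sub>v x) = (\<Sum>j<?n. smult (x $ j) (vec_poly (row ?M j)))"
    using M x by (simp add: vec_poly_mult_mat_vec[of _ ?n ?n])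
  also have "\<dots> = (\<Sum>j<?n. \<Sum>k\<le>degree f.
      smult (x $ j * poly.coeff f k) (vec_poly (row (?C ^\<^sub>m k) j)))"
    by (intro sum.cong) (auto simp: row smult_sum_right)
  finally have 1: "vec_poly (transpose_mat ?M *\<^sub>v x) = \<dots>" .
  have "f * vec_poly x = vec_poly x * (\<Sum>k\<le>degree f. Polynomial.monom (poly.coeff f k) k)"
    by (simp add: poly_as_sum_of_monoms mult.commute)
  also have "\<dots> = (\<Sum>j<?n. \<Sum>k\<le>degree f.
      smult (x $ j * poly.coeff f k) (Polynomial.monom 1 (k + (?n - 1 - j))))"
    using x by (simp add: vec_poly_def sum_product mult_monom smult_monom add.commute)
  finally have 2: "f * vec_poly x = \<dots>" .
  show ?thesis
    unfolding 1 2 sum_subtractf[symmetric] smult_diff_right[symmetric]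
    using vec_poly_row_companion_mat_power[OF g] by (intro dvd_sum dvd_smult) auto
qed

text \<open>The given \<open>b'\<close> is a quotient only modulo \<open>p\<close>, so a true monic
  quotient \<open>b\<close> is built first. Its \<open>k\<close> shifts are independent in the
  kernel, whence \<open>k \<le> m\<close>. Conversely the \<open>m\<close> kernel vectors read off
  the diagonal form are, modulo \<open>p\<close>, multiples of \<open>b\<close> with cofactors of
  degree below \<open>k\<close>, whence \<open>m \<le> k\<close>.\<close>

lemma card_dvd_diagonal_eq_degree:
  fixes g :: "'a::idom poly"
  assumes p: "prime_elem p" and g: "lead_coeff g = 1" and n: "n = degree g"
    and carr: "A \<in> carrier_mat n n" "P \<in> carrier_mat n n" "P' \<in> carrier_mat n n"
      "Q \<in> carrier_mat n n" "Q' \<in> carrier_mat n n"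
    and inv: "P' * P = 1\<^sub>m n" "Q * Q' = 1\<^sub>m n" "Q' * Q = 1\<^sub>m n"
    and diag: "diagonal_mat (P * A * Q)"
    and act: "\<And>x. x \<in> carrier_vec n \<Longrightarrow> g dvd vec_poly (A *\<^sub>v x) - f * vec_poly x"
    and d: "lead_coeff d = 1"
    and fd: "[:p:] dvd f - d * a" and gd: "[:p:] dvd g - d * b'"
    and bezout: "[:p:] dvd d - (u * f + v * g)"
  shows "card {i. i < n \<and> p dvd (P * A * Q) $$ (i, i)} = degree d"
proof -
  define m where "m = card {i. i < n \<and> p dvd (P * A * Q) $$ (i, i)}"
  define k where "k = degree d"
  from p have pz: "prime_or_zero p" by (simp add: prime_or_zero_def)
  have p1: "\<not> p dvd 1" using p by (simp add: prime_elem_def)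
  \<comment> \<open>Division in R[t] is exact up to \<open>r\<close>; being reduced modulo the monic
    \<open>d\<close> and congruent to a multiple of \<open>p\<close>, \<open>r\<close> vanishes
    modulo \<open>p\<close>.\<close>
  obtain b r where br: "g = d * b + r" "r = 0 \<or> degree r < degree d"
    using monic_division[OF d] by blast
  from gd obtain z where "g - d * b' = [:p:] * z" by (elim dvdE)
  then have "r - [:p:] * z = d * (b' - b)" by (simp add: br(1) algebra_simps)
  then have r: "[:p:] dvd r" using const_dvd_if_cong_monic[OF d br(2), of p z] by simp
  have b0: "b \<noteq> 0"
  proof
    assume "b = 0"
    then have "[:p:] dvd g" using br r by simp
    then have "p dvd lead_coeff g" by (simp only: const_poly_dvd_iff)
    then show False using g p1 by simp
  qed
  have d0: "d \<noteq> 0" using d by auto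
  have deg_db: "degree (d * b) = k + degree b" using b0 d0 by (simp add: degree_mult_eq k_def)
  \<comment> \<open>The remainder is too short to affect the top of \<open>d * b\<close>, so
    \<open>g\<close> has the same degree and leading coefficient and \<open>b\<close> is
    monic.\<close>
  have small: "degree r < degree (d * b) \<or> r = 0" using br(2) deg_db by (auto simp: k_def)
  have degb: "n = k + degree b"
    using small by (auto simp: n br(1) degree_add_eq_left deg_db)
  have "degree g = degree (d * b)" using degb deg_db n by simp
  then have "lead_coeff g = lead_coeff (d * b)"
    using small by (simp only: br(1) coeff_add) (auto simp: coeff_eq_0)
  then have b: "lead_coeff b = 1" using g d by (simp add: lead_coeff_mult)
  obtain s where s: "r = [:p:] * s" using r by (elim dvdE)
  obtain e where e: "f = d * a + [:p:] * e" using fd by (elim dvdE) (simp add: algebra_simps)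
  have "k \<le> m"
  proof (rule ccontr)
    assume "\<not> k \<le> m"
    \<comment> \<open>The columns are the coordinates of b t^j; since
      \<open>n = k + degree b\<close>, these need no reduction modulo \<open>g\<close>.\<close>
    define W where "W = mat n k (\<lambda>(i, j). poly.coeff (b * Polynomial.monom 1 j) (n - 1 - i))"
    have W: "W \<in> carrier_mat n k" by (simp add: W_def)
    have col: "vec_poly (col W j) = b * Polynomial.monom 1 j" if "j < k" for j
    proof -
      have "col W j = vec n (\<lambda>i. poly.coeff (b * Polynomial.monom 1 j) (n - 1 - i))"
        using that by (intro eq_vecI) (auto simp: W_def)
      moreover have "degree (b * Polynomial.monom 1 j) < n"
        using that b0 degb by (simp add: degree_mult_eq degree_monom_eq)
      ultimately show ?thesis by (simp add: vec_poly_vec)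
    qed
    have "dvd_vec p (A *\<^sub>v col W j)" if j: "j < k" for j
    proof -
      let ?t = "Polynomial.monom (1 :: 'a) j" and ?h = "vec_poly (A *\<^sub>v col W j)"
      \<comment> \<open>Modulo \<open>p\<close> the product of \<open>f\<close> and b t^j is g a
        t^j. Adding this multiple of \<open>g\<close> shows the image to be a multiple of
        \<open>p\<close> modulo \<open>g\<close>.\<close>
      have "g dvd (?h - f * vec_poly (col W j)) + g * (a * ?t)"
        using act[of "col W j"] W j by (intro dvd_add) (auto simp: carrier_vecI)
      also have "(?h - f * vec_poly (col W j)) + g * (a * ?t) = ?h - [:p:] * (e * b * ?t - s * a * ?t)"
        unfolding col[OF j] by (simp only: e br(1) s) (simp only: algebra_simps)
      finally have "[:p:] dvd ?h"
        using const_dvd_if_cong_monic[OF g] degree_vec_poly[of "A *\<^sub>v col W j"] carr n by simp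
      then show ?thesis by (simp add: const_dvd_vec_poly_iff)
    qed
    then have "dvd_mat p (A * W)"
      using carr W by (auto simp: dvd_mat_def dvd_vec_def)
    from kernel_dependent_mod[OF pz carr(1,2,4,5) W inv(2) diag this] \<open>\<not> k \<le> m\<close>
    obtain c where c: "c \<in> carrier_vec k" "\<not> dvd_vec p c" "dvd_vec p (W *\<^sub>v c)"
      by (auto simp: m_def)
    have Wc: "vec_poly (W *\<^sub>v c) = b * (\<Sum>j<k. Polynomial.monom (c $ j) j)"
    proof -
      have "smult (c $ j) (b * Polynomial.monom 1 j) = b * Polynomial.monom (c $ j) j" for j
        by (simp only: mult_smult_right[symmetric] smult_monom mult_1_right)
      then show ?thesis using c W by (simp add: vec_poly_mult_mat_vec col sum_distrib_left del: mult_smult_right)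
    qed
    \<comment> \<open>The dependency makes \<open>p\<close> divide \<open>b\<close> times the
      polynomial with coefficients \<open>c\<close>, and the monic \<open>b\<close> cancels.\<close>
    have "[:p:] dvd (\<Sum>j<k. Polynomial.monom (c $ j) j)"
      using c(3) unfolding const_dvd_vec_poly_iff[symmetric] Wc
      by (rule prime_const_dvd_monic_multD[OF p b])
    then have "p dvd poly.coeff (\<Sum>j<k. Polynomial.monom (c $ j) j) i" for i
      by (simp only: const_poly_dvd_iff)
    moreover have "poly.coeff (\<Sum>j<k. Polynomial.monom (c $ j) j) i = c $ i" if "i < k" for i
      using that by (simp add: coeff_sum)
    ultimately have "dvd_vec p c" using c(1) by (metis dvd_vec_def carrier_vecD)
    then show False using c(2) by simp
  qed
  moreover have "m \<le> k"
  proof (rule ccontr)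
    assume "\<not> m \<le> k"
    obtain Y where Y: "Y \<in> carrier_mat n m" "dvd_mat p (A * Y)"
      and ind: "\<And>c. c \<in> carrier_vec m \<Longrightarrow> dvd_vec p (Y *\<^sub>v c) \<Longrightarrow> dvd_vec p c"
      using kernel_independent_mod[OF carr inv(1,3) diag m_def] by blast
    have "\<exists>z. [:p:] dvd vec_poly (col Y j) - b * z \<and> (z = 0 \<or> degree z < k)" if j: "j < m" for j
    proof -
      define q where "q = vec_poly (col Y j)"
      define h where "h = vec_poly (A *\<^sub>v col Y j)"
      have "dvd_vec p (A *\<^sub>v col Y j)"
        using Y j carr by (auto simp: dvd_mat_def dvd_vec_def)
      then have "[:p:] dvd h" by (simp add: h_def const_dvd_vec_poly_iff)
      then obtain h' where h': "h = [:p:] * h'" by (elim dvdE)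
      have "g dvd h - f * q" using act[of "col Y j"] Y j by (simp add: h_def q_def carrier_vecI)
      then obtain w where w: "h - f * q = g * w" by (elim dvdE)
      from bezout obtain x where x: "d - (u * f + v * g) = [:p:] * x" by (elim dvdE)
      \<comment> \<open>The Bezout argument below yields the cofactor \<open>v * q - u * w\<close>,
        whose degree is not controlled; \<open>z\<close> takes its place.\<close>
      obtain z r' where zr: "q = b * z + r'" "r' = 0 \<or> degree r' < degree b"
        using monic_division[OF b] by blast
      have fq: "f * q = [:p:] * h' - g * w" using w h' by (simp add: algebra_simps)
      have d_eq: "d = u * f + v * g + [:p:] * x" using x by (simp add: algebra_simps)
      \<comment> \<open>Bezout passes divisibility by \<open>g\<close> modulo \<open>p\<close> from
        \<open>f * q\<close> to \<open>d * q\<close>; as \<open>g\<close> is \<open>d * b\<close>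
        modulo \<open>p\<close>, cancelling \<open>d\<close> leaves \<open>q\<close> a multiple of
        \<open>b\<close>.\<close>
      have "d * q = u * (f * q) + g * (v * q) + [:p:] * (x * q)"
        by (subst d_eq) (simp only: algebra_simps)
      also have "\<dots> = d * (b * (v * q - u * w)) + [:p:] * (u * h' + x * q + s * (v * q - u * w))"
        unfolding fq br(1) s by (simp only: algebra_simps)
      finally have "d * (q - b * (v * q - u * w)) = [:p:] * (u * h' + x * q + s * (v * q - u * w))"
        by (simp add: algebra_simps)
      then have "[:p:] dvd q - b * (v * q - u * w)"
        using prime_const_dvd_monic_multD[OF p d] by (metis dvd_triv_left)
      then obtain y where y: "q - b * (v * q - u * w) = [:p:] * y" by (elim dvdE)
      have "r' - [:p:] * y = b * ((v * q - u * w) - z)"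
        unfolding y[symmetric] using zr(1) by (simp add: algebra_simps)
      then have "[:p:] dvd r'" using const_dvd_if_cong_monic[OF b zr(2), of p y] by simp
      moreover have "degree z < k" if "z \<noteq> 0"
      proof -
        have bz: "degree (b * z) = degree b + degree z" using b0 that by (simp add: degree_mult_eq)
        have "degree q = degree (b * z)"
          using zr bz by (auto simp: degree_add_eq_left)
        moreover have "q \<noteq> 0 \<Longrightarrow> degree q < n"
          using degree_vec_poly[of "col Y j"] Y by (auto simp: q_def)
        moreover have "q \<noteq> 0"
        proof
          assume "q = 0"
          then have "b * z = - r'" using zr(1) by (simp add: eq_neg_iff_add_eq_0)
          then show False using bz zr(2) b0 that by (cases "r' = 0") auto
        qed
        ultimately show ?thesis using bz degb by simp
      qed
      ultimately show ?thesis using zr(1) by (intro exI[of _ z]) (auto simp: q_def)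
    qed
    then obtain z where z: "\<And>j. j < m \<Longrightarrow> [:p:] dvd vec_poly (col Y j) - b * z j"
      "\<And>j. j < m \<Longrightarrow> z j = 0 \<or> degree (z j) < k" by metis
    \<comment> \<open>More than \<open>k\<close> polynomials with \<open>k\<close> coefficients each
      are dependent modulo \<open>p\<close>, and multiplying by \<open>b\<close> carries the
      dependency over to the columns of \<open>Y\<close>.\<close>
    obtain c where c: "\<exists>j<m. \<not> p dvd c j" "\<forall>i<k. p dvd (\<Sum>j<m. poly.coeff (z j) i * c j)"
      using homogeneous_system_mod[OF pz, of "{..<m}" k "\<lambda>i j. poly.coeff (z j) i"] \<open>\<not> m \<le> k\<close> by auto
    have "p dvd (\<Sum>j<m. poly.coeff (z j) i * c j)" for i
    proof (cases "i < k")
      case False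
      then have "poly.coeff (z j) i = 0" if "j < m" for j
        using z(2)[OF that] by (auto intro: coeff_eq_0)
      then show ?thesis by simp
    qed (use c in auto)
    then have comb: "[:p:] dvd (\<Sum>j<m. smult (c j) (z j))"
      unfolding const_poly_dvd_iff by (simp add: coeff_sum mult.commute)
    have "[:p:] dvd b * (\<Sum>j<m. smult (c j) (z j)) +
        (\<Sum>j<m. smult (c j) (vec_poly (col Y j) - b * z j))"
      using z(1) by (intro dvd_add[OF dvd_mult[OF comb]] dvd_sum dvd_smult) auto
    also have "\<dots> = vec_poly (Y *\<^sub>v vec m c)"
      using Y(1) by (simp add: vec_poly_mult_mat_vec smult_diff_right sum_subtractf sum_distrib_left)
    finally have "dvd_vec p (vec m c)" using ind by (simp add: const_dvd_vec_poly_iff)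
    then show False using c(1) by (auto simp: dvd_vec_def)
  qed
  ultimately show ?thesis by (simp add: m_def k_def)
qed

section \<open>Residue fields and lifts of gcds\<close>

lemma type_ring_simps [simp]:
  "carrier (type_ring :: 'a::comm_ring_1 ring) = UNIV"
  "x \<otimes>\<^bsub>type_ring\<^esub> y = (x * y :: 'a)" "x \<oplus>\<^bsub>type_ring\<^esub> y = x + y"
  "\<one>\<^bsub>type_ring\<^esub> = (1 :: 'a)" "\<zero>\<^bsub>type_ring\<^esub> = (0 :: 'a)"
  by (simp_all add: ring_of_type_algebra_def)

lemma type_ring_PIdl: "PIdl\<^bsub>type_ring\<^esub> (p :: 'a::comm_ring_1) = {x. p dvd x}"
  by (auto simp: cgenideal_def dvd_def mult.commute)

lemma type_ring_divides_iff: "a divides\<^bsub>type_ring\<^esub> b \<longleftrightarrow> (a :: 'a::comm_ring_1) dvd b"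
  by (auto simp: factor_def dvd_def)

lemma type_ring_Units: "Units (type_ring :: 'a::comm_ring_1 ring) = {x. x dvd 1}"
  by (auto simp: Units_def dvd_def mult.commute)

lemma ring_prime_type_ring_iff: "ring_prime\<^bsub>type_ring\<^esub> (p :: 'a::comm_ring_1) \<longleftrightarrow> prime_elem p"
  by (auto simp: ring_prime_def Divisibility.prime_def type_ring_divides_iff type_ring_Units prime_elem_def)

lemma field_quot_by:
  fixes p :: "'a::idom"
  assumes pid: "principal_domain (type_ring :: 'a ring)" and p: "prime_elem p"
  shows "field (quot_by p)"
proof -
  interpret principal_domain "type_ring :: 'a ring" by (rule pid)
  have "p \<in> carrier type_ring - {\<zero>\<^bsub>type_ring\<^esub>}" using p by (simp add: prime_elem_def)
  then show ?thesis
    using field_iff_prime p unfolding quot_by_def ring_prime_type_ring_iff by blast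
qed

lemma ex_prime_elem_dvd:
  fixes a :: "'a::idom"
  assumes pid: "principal_domain (type_ring :: 'a ring)" and a: "a \<noteq> 0" "\<not> a dvd 1"
  shows "\<exists>p. prime_elem p \<and> p dvd a"
proof -
  interpret principal_domain "type_ring :: 'a ring" by (rule pid)
  have "a \<in> carrier type_ring - {\<zero>\<^bsub>type_ring\<^esub>}" "a \<notin> Units type_ring"
    using a by (simp_all add: type_ring_Units)
  then obtain p where p: "p \<in> carrier type_ring" "ring_irreducible\<^bsub>type_ring\<^esub> p"
      "p divides\<^bsub>type_ring\<^esub> a"
    by (rule exists_irreducible_divisor)
  from primeness_condition[OF p(1)] p(2,3) show ?thesis
    unfolding ring_prime_type_ring_iff type_ring_divides_iff by blast
qed

section \<open>The residue map and lifts to R[t]\<close>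

definition residue :: "'a::comm_ring_1 \<Rightarrow> 'a \<Rightarrow> 'a set" where
  "residue p a = PIdl\<^bsub>type_ring\<^esub> p +>\<^bsub>type_ring\<^esub> a"

lemma residue_hom: "ring_hom_ring type_ring (quot_by p) (residue p)"
proof -
  interpret cring "type_ring :: 'a ring" by (rule cring_from_type_algebra)
  interpret ideal "PIdl\<^bsub>type_ring\<^esub> p" "type_ring :: 'a ring" by (rule cgenideal_ideal) simp
  show ?thesis using rcos_ring_hom_ring unfolding quot_by_def residue_def .
qed

lemma residue_eq_iff: "residue p a = residue p b \<longleftrightarrow> (p :: 'a::comm_ring_1) dvd a - b"
proof -
  have "residue p c = {x. p dvd x - c}" for c
    unfolding residue_def a_r_coset_def' type_ring_PIdl type_ring_simps
    by (auto intro!: exI[of _ "_ - c"] simp: algebra_simps)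
  moreover have "p dvd x - b \<longleftrightarrow> p dvd x - a" if "p dvd a - b" for x
    using dvd_add_right_iff[OF that, of "x - a"] by simp
  ultimately show ?thesis by (auto simp: set_eq_iff)
qed

lemma residue_surj: "A \<in> carrier (quot_by p) \<Longrightarrow> \<exists>a. A = residue p a"
  by (auto simp: quot_by_def FactRing_def A_RCOSETS_def' residue_def)

text \<open>Comparing coefficient by coefficient makes list order and dropped leading zeros
  invisible. \<open>f\<close> is determined only modulo \<open>p\<close> and may have larger degree
  than \<open>F\<close>.\<close>

definition lifts :: "'a::comm_ring_1 \<Rightarrow> 'a set list \<Rightarrow> 'a poly \<Rightarrow> bool" where
  "lifts p F f \<longleftrightarrow> F \<in> carrier (poly_ring (quot_by p)) \<and>
     (\<forall>i. ring.coeff (quot_by p) F i = residue p (poly.coeff f i))"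

context
  fixes p :: "'a::idom"
  assumes field_quot: "field (quot_by p)"
begin

interpretation K: Ring.field "quot_by p" by (rule field_quot)

interpretation h: ring_hom_ring "type_ring :: 'a ring" "quot_by p" "residue p"
  by (rule residue_hom)

lemma residue_zero: "residue p 0 = \<zero>\<^bsub>quot_by p\<^esub>"
  using h.hom_zero by simp

lemma residue_closed: "residue p a \<in> carrier (quot_by p)"
  using h.hom_closed[of a] by simp

lemma residue_add: "residue p (a + b) = residue p a \<oplus>\<^bsub>quot_by p\<^esub> residue p b"
  using h.hom_add[of a b] by simp

lemma residue_mult: "residue p (a * b) = residue p a \<otimes>\<^bsub>quot_by p\<^esub> residue p b"
  using h.hom_mult[of a b] by simp

lemma residue_sum:
  "finite A \<Longrightarrow> residue p (sum f A) = finsum (quot_by p) (\<lambda>x. residue p (f x)) A"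
  by (induction A rule: finite_induct)
    (auto simp: residue_zero residue_add residue_closed K.finsum_insert Pi_iff)

lemma poly_ring_carrier_iff:
  "F \<in> carrier (poly_ring (quot_by p)) \<longleftrightarrow> polynomial\<^bsub>quot_by p\<^esub> (carrier (quot_by p)) F"
  by (simp add: univ_poly_carrier)

lemma lifts_coeffs:
  assumes "lifts p F f"
  shows "set F \<subseteq> carrier (quot_by p)"
  using assms by (auto simp: lifts_def poly_ring_carrier_iff dest: K.polynomial_incl)

lemma lifts_add:
  assumes "lifts p F f" "lifts p G g"
  shows "lifts p (F \<oplus>\<^bsub>poly_ring (quot_by p)\<^esub> G) (f + g)"
proof -
  interpret UP: domain "poly_ring (quot_by p)"
    by (rule K.univ_poly_is_domain[OF K.carrier_is_subring])
  have "F \<oplus>\<^bsub>poly_ring (quot_by p)\<^esub> G \<in> carrier (poly_ring (quot_by p))"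
    using assms by (auto simp: lifts_def)
  moreover have "ring.coeff (quot_by p) (F \<oplus>\<^bsub>poly_ring (quot_by p)\<^esub> G) i = residue p (poly.coeff (f + g) i)" for i
    using assms unfolding univ_poly_add K.poly_add_coeff[OF lifts_coeffs[OF assms(1)] lifts_coeffs[OF assms(2)]]
    by (simp only: lifts_def coeff_add residue_add)
  ultimately show ?thesis by (simp add: lifts_def)
qed

lemma lifts_mult:
  assumes "lifts p F f" "lifts p G g"
  shows "lifts p (F \<otimes>\<^bsub>poly_ring (quot_by p)\<^esub> G) (f * g)"
proof -
  interpret UP: domain "poly_ring (quot_by p)"
    by (rule K.univ_poly_is_domain[OF K.carrier_is_subring])
  have "F \<otimes>\<^bsub>poly_ring (quot_by p)\<^esub> G \<in> carrier (poly_ring (quot_by p))"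
    using assms by (auto simp: lifts_def)
  moreover have "ring.coeff (quot_by p) (F \<otimes>\<^bsub>poly_ring (quot_by p)\<^esub> G) i = residue p (poly.coeff (f * g) i)" for i
    using assms K.poly_mult_coeff[OF lifts_coeffs[OF assms(1)] lifts_coeffs[OF assms(2)]]
    by (simp add: lifts_def univ_poly_mult coeff_mult residue_sum residue_mult)
  ultimately show ?thesis by (simp add: lifts_def)
qed

lemma lifts_poly_mod: "lifts p (poly_mod p f) f"
proof -
  let ?L = "map (residue p) (rev (coeffs f))"
  have L: "poly_mod p f = K.normalize ?L" by (simp add: poly_mod_def residue_def[abs_def])
  have "set ?L \<subseteq> carrier (quot_by p)" by (auto simp: residue_closed)
  then have "poly_mod p f \<in> carrier (poly_ring (quot_by p))"
    unfolding L poly_ring_carrier_iff by (rule K.normalize_gives_polynomial)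
  moreover have "K.coeff ?L i = residue p (poly.coeff f i)" for i
  proof (cases "i < length (coeffs f)")
    case True
    then have "K.coeff ?L i = ?L ! (length ?L - 1 - i)" by (intro K.coeff_nth) simp
    then show ?thesis
      using True by (simp add: rev_nth nth_default_coeffs_eq[symmetric] nth_default_nth)
  next
    case False
    then have "K.coeff ?L i = \<zero>\<^bsub>quot_by p\<^esub>" by (intro K.coeff_length) simp
    moreover have "poly.coeff f i = 0"
      using False by (cases "f = 0") (auto simp: length_coeffs_degree intro: coeff_eq_0)
    ultimately show ?thesis by (simp add: residue_zero)
  qed
  ultimately show ?thesis unfolding lifts_def L K.normalize_coeff[symmetric] by simp
qed

lemma lifts_unique: "lifts p F f \<Longrightarrow> lifts p F g \<Longrightarrow> [:p:] dvd f - g"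
  by (simp add: lifts_def const_poly_dvd_iff residue_eq_iff[of p, symmetric])

text \<open>Representatives are chosen for the listed coefficients only. The leading one is nonzero
  modulo \<open>p\<close>, which preserves the degree; the empty list gives degree 0 on both
  sides.\<close>

lemma ex_lifts:
  assumes F: "F \<in> carrier (poly_ring (quot_by p))"
  shows "\<exists>f. lifts p F f \<and> degree f = Polynomials.degree F \<and> (F \<noteq> [] \<longrightarrow> \<not> p dvd lead_coeff f)"
proof -
  have FK: "polynomial\<^bsub>quot_by p\<^esub> (carrier (quot_by p)) F" using F by (simp add: poly_ring_carrier_iff)
  have "\<forall>i. \<exists>a. K.coeff F i = residue p a"
    using K.coeff_in_carrier[OF K.polynomial_incl[OF FK]] residue_surj by blast
  then obtain a where a: "\<And>i. K.coeff F i = residue p (a i)" by metis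
  define f where "f = Poly (map a [0..<length F])"
  have cf: "poly.coeff f i = (if i < length F then a i else 0)" for i
    by (simp add: f_def nth_default_def)
  have "lifts p F f"
    using F a K.coeff_length[of F] by (auto simp: lifts_def cf residue_zero)
  moreover have "degree f = Polynomials.degree F \<and> (F \<noteq> [] \<longrightarrow> \<not> p dvd lead_coeff f)"
  proof (cases "F = []")
    case True
    then show ?thesis by (simp add: f_def)
  next
    case False
    let ?k = "length F - 1"
    have "K.coeff F ?k \<noteq> \<zero>\<^bsub>quot_by p\<^esub>"
      using FK False K.lead_coeff_simp[OF False] by (simp add: polynomial_def)
    then have "residue p (a ?k) \<noteq> residue p 0" using a by (simp add: residue_zero)
    then have nd: "\<not> p dvd a ?k" by (simp add: residue_eq_iff)
    then have "a ?k \<noteq> 0" by auto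
    then have "degree f = ?k"
      using False by (intro antisym degree_le le_degree) (auto simp: cf)
    then show ?thesis using nd False by (simp add: cf)
  qed
  ultimately show ?thesis by blast
qed

lemma ex_inverse_mod:
  assumes "\<not> p dvd a"
  shows "\<exists>c. p dvd a * c - 1"
proof -
  have "residue p a \<noteq> \<zero>\<^bsub>quot_by p\<^esub>"
    using assms residue_eq_iff[of p a 0] by (simp add: residue_zero)
  then have "residue p a \<in> Units (quot_by p)" using residue_closed by (simp add: K.field_Units)
  then obtain C where C: "C \<in> carrier (quot_by p)" "residue p a \<otimes>\<^bsub>quot_by p\<^esub> C = \<one>\<^bsub>quot_by p\<^esub>"
    by (auto simp: Units_def)
  from residue_surj[OF C(1)] obtain c where "C = residue p c" by blast
  then have "residue p (a * c) = residue p 1" using C h.hom_one by (simp add: residue_mult)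
  then show ?thesis by (auto simp: residue_eq_iff)
qed

text \<open>The chosen gcd need not be monic, and a lift is fixed only modulo \<open>p\<close>;
  making the leading coefficient exactly 1 has to be carried through all three congruences.\<close>

lemma ex_gcd_lift:
  assumes g: "lead_coeff g = 1"
  obtains d a b u v where "lead_coeff d = 1" "degree d = deg_gcd_mod p f g"
    "[:p:] dvd f - d * a" "[:p:] dvd g - d * b" "[:p:] dvd d - (u * f + v * g)"
proof -
  let ?R = "poly_ring (quot_by p)"
  interpret UP: principal_domain ?R
    by (rule K.univ_poly_is_principal[OF K.carrier_is_subfield])
  define F where "F = poly_mod p f"
  define G where "G = poly_mod p g"
  define D where "D = somegcd ?R F G"
  have FG: "lifts p F f" "lifts p G g" by (simp_all add: F_def G_def lifts_poly_mod)
  then have carr: "F \<in> carrier ?R" "G \<in> carrier ?R" by (auto simp: lifts_def)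
  \<comment> \<open>\<open>somegcd\<close> is a Hilbert choice, so a gcd must be exhibited first: a
    generator of the sum of the two ideals.\<close>
  obtain d where "d \<in> carrier ?R" "PIdl\<^bsub>?R\<^esub> F <+>\<^bsub>?R\<^esub> PIdl\<^bsub>?R\<^esub> G = PIdl\<^bsub>?R\<^esub> d"
    using UP.exists_gen[OF UP.add_ideals[OF carr[THEN UP.cgenideal_ideal]]] by blast
  then have "d \<in> carrier ?R \<and> d gcdof\<^bsub>?R\<^esub> F G"
    using UP.ideal_sum_iff_gcd[OF carr] by blast
  then have "D \<in> carrier ?R \<and> D gcdof\<^bsub>?R\<^esub> F G"
    unfolding D_def somegcd_def by (rule someI)
  then have D: "D \<in> carrier ?R" "D divides\<^bsub>?R\<^esub> F" "D divides\<^bsub>?R\<^esub> G" by (auto simp: isgcd_def)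
  obtain A where A: "A \<in> carrier ?R" "F = D \<otimes>\<^bsub>?R\<^esub> A" using D(2) by (auto simp: factor_def)
  obtain B where B: "B \<in> carrier ?R" "G = D \<otimes>\<^bsub>?R\<^esub> B" using D(3) by (auto simp: factor_def)
  have "D \<in> PIdl\<^bsub>?R\<^esub> F <+>\<^bsub>?R\<^esub> PIdl\<^bsub>?R\<^esub> G"
    using UP.bezout_identity[OF carr] UP.cgenideal_self[OF D(1)] by (simp add: D_def)
  then obtain U V where UV: "U \<in> carrier ?R" "V \<in> carrier ?R"
    "D = U \<otimes>\<^bsub>?R\<^esub> F \<oplus>\<^bsub>?R\<^esub> V \<otimes>\<^bsub>?R\<^esub> G"
    by (auto simp: set_add_def' cgenideal_def)
  from ex_lifts[OF D(1)] obtain d where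
    d: "lifts p D d" "degree d = Polynomials.degree D" "D \<noteq> [] \<longrightarrow> \<not> p dvd lead_coeff d" by blast
  from ex_lifts A(1) obtain a where a: "lifts p A a" by blast
  from ex_lifts B(1) obtain b where b: "lifts p B b" by blast
  from ex_lifts UV(1) obtain u where u: "lifts p U u" by blast
  from ex_lifts UV(2) obtain v where v: "lifts p V v" by blast
  have fd: "[:p:] dvd f - d * a" using lifts_unique[OF FG(1)] lifts_mult[OF d(1) a] A(2) by simp
  have gd: "[:p:] dvd g - d * b" using lifts_unique[OF FG(2)] lifts_mult[OF d(1) b] B(2) by simp
  have duv: "[:p:] dvd d - (u * f + v * g)"
    using lifts_unique[OF d(1)] lifts_add[OF lifts_mult[OF u FG(1)] lifts_mult[OF v FG(2)]] UV(3) by simp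
  have not1: "\<not> p dvd 1"
    using residue_eq_iff[of p 1 0] h.hom_one residue_zero K.one_not_zero by simp
  have "D \<noteq> []"
  proof
    assume "D = []"
    then have "lifts p D 0" using D(1) by (simp add: lifts_def residue_zero)
    then have "[:p:] dvd d - 0" using lifts_unique[OF d(1)] by blast
    then have "[:p:] dvd d * b" by simp
    from dvd_add[OF gd this] have "[:p:] dvd g" by simp
    then have "p dvd lead_coeff g" by (simp only: const_poly_dvd_iff)
    then show False using g not1 by simp
  qed
  with d(3) have nd: "\<not> p dvd lead_coeff d" by simp
  then obtain c where c: "p dvd lead_coeff d * c - 1" using ex_inverse_mod by blast
  \<comment> \<open>Scaling by \<open>c\<close> makes the leading coefficient 1 only modulo
    \<open>p\<close>; the excess, a multiple of \<open>p\<close>, is subtracted.\<close>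
  define d' where "d' = smult c d - Polynomial.monom (lead_coeff d * c - 1) (degree d)"
  have cd: "[:p:] dvd smult c d - d'"
    using c by (auto simp: d'_def const_poly_dvd_iff)
  have lc: "poly.coeff d' (degree d) = 1" by (simp add: d'_def mult.commute)
  have deg: "degree d' = degree d"
  proof (rule antisym)
    show "degree d' \<le> degree d"
      unfolding d'_def by (intro degree_diff_le degree_smult_le degree_monom_le)
    show "degree d \<le> degree d'" using lc by (intro le_degree) simp
  qed
  have dd: "[:p:] dvd d - d' * [:lead_coeff d:]"
  proof -
    have "[:p:] dvd smult (lead_coeff d * c - 1) d" using c by (simp add: const_poly_dvd_iff)
    with dvd_smult[OF cd]
    have "[:p:] dvd smult (lead_coeff d) (smult c d - d') - smult (lead_coeff d * c - 1) d"
      by (rule dvd_diff)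
    also have "\<dots> = d - d' * [:lead_coeff d:]" by (simp add: smult_diff_right smult_diff_left)
    finally show ?thesis .
  qed
  \<comment> \<open>Modulo \<open>p\<close>, \<open>d'\<close> is \<open>c\<close> times
    \<open>d\<close>, and \<open>d\<close> is \<open>lead_coeff d\<close> times \<open>d'\<close>:
    the Bezout coefficients absorb the former factor, the cofactors the latter.\<close>
  show ?thesis
  proof (rule that[of d' "[:lead_coeff d:] * a" "[:lead_coeff d:] * b" "smult c u" "smult c v"])
    show "lead_coeff d' = 1" using lc deg by simp
    show "degree d' = deg_gcd_mod p f g"
      using deg d(2) by (simp add: deg_gcd_mod_def D_def F_def G_def)
    have eq: "x - d' * ([:lead_coeff d:] * y) = (x - d * y) + (d - d' * [:lead_coeff d:]) * y"
      for x y by (simp only: algebra_simps)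
    show "[:p:] dvd f - d' * ([:lead_coeff d:] * a)" "[:p:] dvd g - d' * ([:lead_coeff d:] * b)"
      unfolding eq using fd gd dd by (simp_all only: dvd_add dvd_mult2)
    have "[:p:] dvd smult c (d - (u * f + v * g)) - (smult c d - d')"
      by (rule dvd_diff[OF dvd_smult[OF duv] cd])
    then show "[:p:] dvd d' - (smult c u * f + smult c v * g)"
      by (simp add: smult_diff_right smult_add_right algebra_simps)
  qed
qed

end

section \<open>Counting invariant factors\<close>

lemma invertible_mat_obtains:
  assumes "A \<in> carrier_mat n n" "invertible_mat A"
  obtains B where "B \<in> carrier_mat n n" "A * B = 1\<^sub>m n" "B * A = 1\<^sub>m n"
proof -
  from assms obtain B where B: "A * B = 1\<^sub>m n" "B * A = 1\<^sub>m (dim_row B)"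
    by (auto simp: invertible_mat_def inverts_mat_def)
  have "dim_row B = n" using arg_cong[OF B(2), of dim_col] assms(1) by simp
  moreover have "dim_col B = n" using arg_cong[OF B(1), of dim_col] by simp
  ultimately show ?thesis using B by (intro that[of B]) auto
qed

text \<open>The transpose \<open>M\<^sup>T\<close> acts on coordinate columns as multiplication by \<open>f\<close> on
  \<open>R[t]/(g)\<close>, so the diagonal form is transposed as well.\<close>
lemma card_dvd_smith_eq_deg_gcd_mod:
  fixes f g :: "'a::idom poly"
  assumes pid: "principal_domain (type_ring :: 'a ring)" and p: "prime_elem p"
    and g: "lead_coeff g = 1" and n: "n = degree g" and M: "M = poly_of_mat f (companion_mat g)"
    and carr: "U \<in> carrier_mat n n" "U' \<in> carrier_mat n n" "V \<in> carrier_mat n n" "V' \<in> carrier_mat n n"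
    and inv: "U * U' = 1\<^sub>m n" "U' * U = 1\<^sub>m n" "V * V' = 1\<^sub>m n"
    and diag: "diagonal_mat (U * M * V)"
  shows "card {i. i < n \<and> p dvd (U * M * V) $$ (i, i)} = deg_gcd_mod p f g"
proof -
  obtain d a b u v where d: "lead_coeff d = 1" "degree d = deg_gcd_mod p f g"
    and lift: "[:p:] dvd f - d * a" "[:p:] dvd g - d * b" "[:p:] dvd d - (u * f + v * g)"
    using ex_gcd_lift[OF field_quot_by[OF pid p] g] .
  have Mc: "M \<in> carrier_mat n n" using companion_mat_carrier[of g] by (simp add: M n poly_of_mat_def)
  have T: "transpose_mat V * transpose_mat M * transpose_mat U = transpose_mat (U * M * V)"
    using carr Mc
    by (simp add: transpose_mult[of _ n n _ n])
  have "card {i. i < n \<and> p dvd (transpose_mat V * transpose_mat M * transpose_mat U) $$ (i, i)} = degree d"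
  proof (rule card_dvd_diagonal_eq_degree[OF p g n _ _ _ _ _ _ _ _ _ _ d(1) lift])
    show "transpose_mat V' * transpose_mat V = 1\<^sub>m n"
      using transpose_mult[OF carr(3,4)] inv(3) by simp
    show "transpose_mat U * transpose_mat U' = 1\<^sub>m n"
      using transpose_mult[OF carr(2,1)] inv(2) by simp
    show "transpose_mat U' * transpose_mat U = 1\<^sub>m n"
      using transpose_mult[OF carr(1,2)] inv(1) by simp
    show "diagonal_mat (transpose_mat V * transpose_mat M * transpose_mat U)"
      unfolding T using diag carr Mc by (auto simp: diagonal_mat_def)
    show "g dvd vec_poly (transpose_mat M *\<^sub>v x) - f * vec_poly x" if "x \<in> carrier_vec n" for x
      using vec_poly_poly_of_companion_mat[OF g] that by (simp add: M n)
  qed (use carr Mc in auto)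
  moreover have "(transpose_mat (U * M * V)) $$ (i, i) = (U * M * V) $$ (i, i)" if "i < n" for i
    using that carr Mc by (intro index_transpose_mat) auto
  ultimately show ?thesis unfolding T d(2) by (metis (mono_tags, lifting) Collect_cong)
qed

theorem theorem3p15:
  fixes f g :: "'a::idom poly" and S :: "'a mat" and \<gamma> :: "nat \<Rightarrow> 'a" and r :: nat
  assumes pid: "principal_domain (type_ring :: 'a ring)"
    and monic: "lead_coeff g = 1"
    and gamma: "\<forall>i\<le>degree g. is_determinantal_divisor (poly_of_mat f (companion_mat g)) i (\<gamma> i)"
    and last_nonzero: "r \<le> degree g" "\<gamma> r \<noteq> 0" "\<forall>i. r < i \<and> i \<le> degree g \<longrightarrow> \<gamma> i = 0"
    and smith: "is_smith_form (poly_of_mat f (companion_mat g)) S"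
    and max_meaningful: "(\<exists>p. prime_elem p \<and> p dvd \<gamma> r) \<or> r = degree g"
  shows "card {i. i < degree g \<and> \<not> S $$ (i, i) dvd 1} =
         Max (insert 0 {deg_gcd_mod p f g | p. prime_elem p \<and> p dvd \<gamma> r})"
proof -
  define n where "n = degree g"
  define M where "M = poly_of_mat f (companion_mat g)"
  have M: "M \<in> carrier_mat n n"
    using companion_mat_carrier[of g] by (simp add: M_def n_def poly_of_mat_def)
  from smith M obtain U V where U: "U \<in> carrier_mat n n" "invertible_mat U"
    and V: "V \<in> carrier_mat n n" "invertible_mat V" and S: "S = U * M * V" and diag: "diagonal_mat S"
    and chain: "\<forall>i. i + 1 < min (dim_row S) (dim_col S) \<longrightarrow> S $$ (i, i) dvd S $$ (i + 1, i + 1)"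
    by (auto simp: is_smith_form_def M_def[symmetric])
  obtain U' where U': "U' \<in> carrier_mat n n" "U * U' = 1\<^sub>m n" "U' * U = 1\<^sub>m n"
    using invertible_mat_obtains[OF U] .
  obtain V' where V': "V' \<in> carrier_mat n n" "V * V' = 1\<^sub>m n" "V' * V = 1\<^sub>m n"
    using invertible_mat_obtains[OF V] .
  define s where "s i = S $$ (i, i)" for i
  have s_mono: "s i dvd s j" if "i \<le> j" "j < n" for i j
    using that
  proof (induction j rule: dec_induct)
    case (step j)
    then have "s j dvd s (Suc j)" using chain S U(1) V(1) M by (simp add: s_def)
    with step show ?case by (meson Suc_lessD dvd_trans)
  qed simp
  have minors_iff: "(\<forall>x\<in>minors M i. p dvd x) \<longleftrightarrow> card {j. j < n \<and> \<not> p dvd s j} < i"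
    if "prime_or_zero p" for p i
    using minor_dvd_if_rank_less[OF that M U(1) U'(1) V(1) V'(1) U'(3) V'(2), of i]
      ex_minor_not_dvd_if_le_rank[OF that M U(1) V(1), of i] diag
    unfolding S[symmetric] s_def by (meson not_le)
  \<comment> \<open>By the universal property of the gcd, \<open>p\<close> divides it iff
    \<open>p\<close> divides all minors of that order.\<close>
  have gamma_iff: "p dvd \<gamma> i \<longleftrightarrow> card {j. j < n \<and> \<not> p dvd s j} < i"
    if "prime_or_zero p" "i \<le> n" for p i
    using gamma that(2) minors_iff[OF that(1), of i]
    unfolding is_determinantal_divisor_def M_def[symmetric] n_def[symmetric] by (meson dvd_trans)
  have zero: "prime_or_zero (0 :: 'a)" by (simp add: prime_or_zero_def)
  \<comment> \<open>The case \<open>p = 0\<close>: \<open>\<gamma> i\<close> vanishes iff fewer than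
    \<open>i\<close> diagonal entries are nonzero, so the last nonvanishing index is the
    rank.\<close>
  have rank: "card {j. j < n \<and> s j \<noteq> 0} = r"
  proof (rule antisym)
    let ?c = "card {j. j < n \<and> s j \<noteq> 0}"
    show "r \<le> ?c"
      using gamma_iff[OF zero, of r] last_nonzero(1,2) by (simp add: n_def)
    have "?c \<le> card {..<n}" by (intro card_mono) auto
    then show "?c \<le> r"
      using gamma_iff[OF zero, of ?c] last_nonzero(3) by (auto simp: n_def not_le)
  qed
  have deg: "deg_gcd_mod p f g = card {i. i < n \<and> p dvd s i}" if "prime_elem p" for p
    using card_dvd_smith_eq_deg_gcd_mod[OF pid that monic n_def M_def U(1) U'(1) V(1) V'(1) U'(2,3) V'(2)]
      diag by (simp add: S[symmetric] s_def)
  define N where "N = {i. i < n \<and> \<not> s i dvd 1}"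
  define W where "W = {deg_gcd_mod p f g | p. prime_elem p \<and> p dvd \<gamma> r}"
  \<comment> \<open>Multiples of a prime are non-units, so no degree in \<open>W\<close> exceeds
    \<open>card N\<close>; it remains to attain this value.\<close>
  have sub: "{i. i < n \<and> p dvd s i} \<subseteq> N" if "prime_elem p" for p
    using that by (auto simp: N_def prime_elem_def dest: dvd_trans)
  have finN: "finite N" by (simp add: N_def)
  have bound: "x \<le> card N" if "x \<in> insert 0 W" for x
    using that card_mono[OF finN sub] deg by (auto simp: W_def)
  have "card N \<in> insert 0 W"
  \<comment> \<open>Without non-units the value is the inserted 0.\<close>
  proof (cases "N = {}")
    case False
    define j where "j = Min N"
    have jN: "j \<in> N" and jle: "\<And>i. i \<in> N \<Longrightarrow> j \<le> i" using finN False by (auto simp: j_def)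
    then have j: "j < n" "\<not> s j dvd 1" by (auto simp: N_def)
    \<comment> \<open>By the divisibility chain, whatever divides the first non-unit divides all of
      them, including the zeros.\<close>
    have N_sub: "N \<subseteq> {i. i < n \<and> p dvd s i}" if "p dvd s j" for p
      using that jle s_mono by (auto simp: N_def intro: dvd_trans)
    have unit: "s i dvd 1" if "i < j" for i using that jle[of i] j(1) by (force simp: N_def)
    show ?thesis
    proof (cases "s j = 0")
      case True
      then have zeros: "s i = 0" if "i \<in> N" for i using N_sub[of 0] that by auto
      \<comment> \<open>All nonzero entries are units, so the rank modulo a prime is still at least
        \<open>r\<close>.\<close>
      have "\<not> p dvd \<gamma> r" if p: "prime_elem p" for p
      proof -
        have "{i. i < n \<and> s i \<noteq> 0} \<subseteq> {i. i < n \<and> \<not> p dvd s i}"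
          using zeros sub[OF p] by blast
        then have "r \<le> card {i. i < n \<and> \<not> p dvd s i}"
          unfolding rank[symmetric] by (intro card_mono) auto
        then show ?thesis using gamma_iff[of p r] p last_nonzero(1) by (auto simp: prime_or_zero_def n_def)
      qed
      \<comment> \<open>The remaining alternative of \<open>max_meaningful\<close> is full rank,
        which contradicts the zero entry \<open>s j\<close>.\<close>
      then have "r = n" using max_meaningful by (auto simp: n_def)
      moreover have "card {i. i < n \<and> s i \<noteq> 0} < card {..<n}"
        using j(1) True by (intro psubset_card_mono) auto
      ultimately show ?thesis using rank by simp
    next
      case False
      obtain p where p: "prime_elem p" "p dvd s j"
        using ex_prime_elem_dvd[OF pid False j(2)] by blast
      \<comment> \<open>Position \<open>j\<close> is lost modulo \<open>p\<close>, so the rank drops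
        below \<open>r\<close> and \<open>p\<close> divides \<open>\<gamma> r\<close>.\<close>
      have "{i. i < n \<and> \<not> p dvd s i} \<subset> {i. i < n \<and> s i \<noteq> 0}"
        using False j(1) p(2) by auto
      then have "card {i. i < n \<and> \<not> p dvd s i} < r"
        unfolding rank[symmetric] by (intro psubset_card_mono) auto
      then have "p dvd \<gamma> r"
        using gamma_iff[of p r] p(1) last_nonzero(1) by (simp add: prime_or_zero_def n_def)
      moreover have "card N = deg_gcd_mod p f g"
        using deg[OF p(1)] sub[OF p(1)] N_sub[OF p(2)] by (metis subset_antisym)
      ultimately show ?thesis using p(1) by (auto simp: W_def)
    qed
  qed simp
  moreover have "finite (insert 0 W)" using bound by (meson finite_nat_set_iff_bounded_le)
  ultimately have "Max (insert 0 W) = card N" using bound by (intro Max_eqI) auto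
  then show ?thesis by (simp add: N_def W_def n_def s_def)
qed

end
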